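(* Let $1<p<+\infty$ and $\omega\in\mathbb R$. Suppose $\tilde\zeta\in\mathring L^p(\mathbb S^2)$ depends only on $x_3$ and is monotone in $x_3$. Then $\tilde\zeta$ is stable in $L^p$ norm of the absolute vorticity: for any $\varepsilon>0$ there exists $\delta>0$ such that for any smooth solution $\zeta$ of the vorticity equation $(V_\omega)$, $$\|\zeta_0-\tilde\zeta\|_{L^p(\mathbb S^2)}<\delta\quad\Longrightarrow\quad\|\zeta_t-\tilde\zeta\|_{L^p(\mathbb S^2)}<\varepsilon\quad\forall\,t>0.$$
   Context: $\mathbb S^2=\{\mathbf x=(x_1,x_2,x_3)\in\mathbb R^3:|\mathbf x|=1\}$ is the unit sphere with the standard metric and area measure $\sigma$, with spherical coordinates $(\varphi,\theta)\mapsto(\cos\theta\cos\varphi,\cos\theta\sin\varphi,\sin\theta)$; thus $\sin\theta=x_3$. All functions are real-valued. $\mathring L^p(\mathbb S^2)$ is the space of $L^p$ functions with zero mean. For $1<r<\infty$ and $f\in\mathring L^r(\mathbb S^2)$, $\mathcal Gf$ is the unique zero-mean function in $W^{2,r}(\mathbb S^2)$ with $-\Delta(\mathcal Gf)=f$ ($\Delta$ the Laplace-Beltrami operator). $J$ is the anticlockwise rotation by $\pi/2$ in the tangent planes, i.e. $J\mathbf v=\mathbf x\times\mathbf v$ at $\mathbf x\in\mathbb S^2$; in coordinates $J\nabla f=-\partial_\theta f\,\mathbf e_\varphi+\frac1{\cos\theta}\partial_\varphi f\,\mathbf e_\theta$. For a fixed rotation speed $\omega\in\mathbb R$, the vorticity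 equation $(V_\omega)$ for the absolute vorticity $\zeta$ is $$\partial_t\zeta+J\nabla(\omega\sin\theta-\mathcal G\zeta)\cdot\nabla\zeta=0\quad\text{on }\mathbb S^2,\ t>0.$$ A smooth solution is a smooth function $\zeta$ on $\mathbb S^2\times[0,\infty)$, of zero mean on $\mathbb S^2$ at each time, satisfying this equation; $\zeta_t:=\zeta(\cdot,t)$. Monotone means non-decreasing or non-increasing (not necessarily strictly). *)

theory Defs
  imports "HOL-Analysis.Analysis"
begin

section \<open>Smooth functions\<close>

fun Ck_on :: "nat \<Rightarrow> 'a::euclidean_space set \<Rightarrow> ('a \<Rightarrow> real) \<Rightarrow> bool" where
  "Ck_on 0 U f \<longleftrightarrow> continuous_on U f"
| "Ck_on (Suc k) U f \<longleftrightarrow>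
     f differentiable_on U \<and> (\<forall>b\<in>Basis. Ck_on k U (\<lambda>x. frechet_derivative f (at x) b))"

text \<open>Smoothness on a subset of a Euclidean space (here a submanifold, possibly with boundary)
  means having a smooth extension to an open neighbourhood.\<close>

definition smooth_on :: "'a::euclidean_space set \<Rightarrow> ('a \<Rightarrow> real) \<Rightarrow> bool" where
  "smooth_on S f \<longleftrightarrow>
     (\<exists>U F. open U \<and> S \<subseteq> U \<and> (\<forall>k. Ck_on k U F) \<and> (\<forall>x\<in>S. F x = f x))"


section \<open>The unit sphere, its area measure and Lebesgue norms\<close>

text \<open>Functions on the sphere are represented by functions on \<open>real^3\<close>; only their values on
  the sphere are ever used.\<close>

abbreviation S2 :: "(real^3) set" where
  "S2 \<equiv> sphere 0 1"

definition spherical :: "real \<times> real \<Rightarrow> real^3" where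
  "spherical = (\<lambda>(\<phi>, \<theta>). vector [cos \<theta> * cos \<phi>, cos \<theta> * sin \<phi>, sin \<theta>])"

text \<open>Area element \<open>cos \<theta> d\<phi> d\<theta>\<close>.\<close>

definition sphere_area :: "(real^3) measure" where
  "sphere_area =
     distr
       (density lborel
          (\<lambda>(\<phi>, \<theta>). ennreal (cos \<theta> * indicator ({0..2*pi} \<times> {-(pi/2)..pi/2}) (\<phi>, \<theta>))))
       (restrict_space borel S2) spherical"

definition in_Lp :: "real \<Rightarrow> (real^3 \<Rightarrow> 'b::euclidean_space) \<Rightarrow> bool" where
  "in_Lp p f \<longleftrightarrow>
     f \<in> borel_measurable sphere_area \<and> integrable sphere_area (\<lambda>x. norm (f x) powr p)"

definition Lp_norm :: "real \<Rightarrow> (real^3 \<Rightarrow> 'b::euclidean_space) \<Rightarrow> real" where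
  "Lp_norm p f = (\<integral>x. norm (f x) powr p \<partial>sphere_area) powr (1 / p)"

definition zero_mean :: "(real^3 \<Rightarrow> real) \<Rightarrow> bool" where
  "zero_mean f \<longleftrightarrow> (\<integral>x. f x \<partial>sphere_area) = 0"


section \<open>Differential calculus on the sphere\<close>

definition pderiv3 :: "3 \<Rightarrow> (real^3 \<Rightarrow> real) \<Rightarrow> real^3 \<Rightarrow> real" where
  "pderiv3 i F x = frechet_derivative F (at x) (axis i 1)"

text \<open>A function \<open>u\<close> on the sphere is differentiated through its extension
  \<open>U y = u (y / |y|)\<close>, which is constant along rays. At points of the sphere, the Euclidean
  gradient of \<open>U\<close> is tangent and equals the Riemannian gradient of \<open>u\<close>. The Euclidean Hessian of
  \<open>U\<close> there agrees with the covariant Hessian of \<open>u\<close> on tangent vectors, satisfies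
  \<open>D\<^sup>2U(x,v) = - \<nabla>u \<bullet> v\<close> for tangent \<open>v\<close> and \<open>D\<^sup>2U(x,x) = 0\<close>; hence its trace is the
  Laplace-Beltrami operator of \<open>u\<close>, and \<open>u\<close>, \<open>grad_S u\<close>, \<open>hess_S u\<close> together control exactly
  the derivatives entering the \<open>W\<^bsup>2,r\<^esup>\<close> norm.\<close>

definition grad_S :: "(real^3 \<Rightarrow> real) \<Rightarrow> real^3 \<Rightarrow> real^3" where
  "grad_S u x = (\<chi> i. pderiv3 i (\<lambda>y. u (sgn y)) x)"

definition hess_S :: "(real^3 \<Rightarrow> real) \<Rightarrow> real^3 \<Rightarrow> real^3^3" where
  "hess_S u x = (\<chi> i j. pderiv3 j (pderiv3 i (\<lambda>y. u (sgn y))) x)"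

definition rot_J :: "real^3 \<Rightarrow> real^3 \<Rightarrow> real^3" where
  "rot_J x v = cross3 x v"


section \<open>Sobolev functions and the inverse of the negative Laplacian\<close>

text \<open>\<open>W\<^bsup>2,r\<^esup>\<close> is the completion of the smooth functions in the Sobolev norm: \<open>u\<close> belongs to it,
  with weak gradient \<open>g\<close> and weak Hessian \<open>H\<close> (both defined up to null sets), iff some sequence
  of smooth functions converges to \<open>u\<close> in \<open>L\<^sup>r\<close> together with its derivatives.\<close>

definition sobolev2 ::
  "real \<Rightarrow> (real^3 \<Rightarrow> real) \<Rightarrow> (real^3 \<Rightarrow> real^3) \<Rightarrow> (real^3 \<Rightarrow> real^3^3) \<Rightarrow> bool" where
  "sobolev2 r u g H \<longleftrightarrow>
     in_Lp r u \<and> in_Lp r g \<and> in_Lp r H \<and>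
     (\<exists>w :: nat \<Rightarrow> real^3 \<Rightarrow> real.
        (\<forall>n. smooth_on S2 (w n)) \<and>
        (\<lambda>n. Lp_norm r (\<lambda>x. w n x - u x)) \<longlonglongrightarrow> 0 \<and>
        (\<lambda>n. Lp_norm r (\<lambda>x. grad_S (w n) x - g x)) \<longlonglongrightarrow> 0 \<and>
        (\<lambda>n. Lp_norm r (\<lambda>x. hess_S (w n) x - H x)) \<longlonglongrightarrow> 0)"

text \<open>\<open>green r f \<psi> g\<close>: \<open>\<psi>\<close> is a version of \<open>\<G> f\<close>, the zero-mean solution of \<open>- \<Delta>\<psi> = f\<close> in
  \<open>W\<^bsup>2,r\<^esup>\<close>, and \<open>g\<close> is a version of \<open>\<nabla>\<psi>\<close>. A relation is used since \<open>\<G> f\<close> is unique only as an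
  equivalence class of functions.\<close>

definition green ::
  "real \<Rightarrow> (real^3 \<Rightarrow> real) \<Rightarrow> (real^3 \<Rightarrow> real) \<Rightarrow> (real^3 \<Rightarrow> real^3) \<Rightarrow> bool" where
  "green r f \<psi> g \<longleftrightarrow>
     zero_mean \<psi> \<and> (\<exists>H. sobolev2 r \<psi> g H \<and> (AE x in sphere_area. - trace (H x) = f x))"


section \<open>Smooth solutions of the vorticity equation\<close>

text \<open>\<open>\<G>\<close> does not depend on the exponent, and a smooth \<open>\<zeta>\<^sub>t\<close> lies in every \<open>L\<^sup>r\<close>, so \<open>\<psi> = \<G> \<zeta>\<^sub>t\<close>
  refers to all \<open>r > 1\<close>. The gradient \<open>g\<close> of the Sobolev function \<open>\<psi>\<close> is only defined up to null
  sets, which is why the equation is required almost everywhere. By elliptic regularity \<open>\<psi>\<close> has a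
  smooth version, so that this amounts to the equation holding at every point.\<close>

definition smooth_solution :: "real \<Rightarrow> (real^3 \<Rightarrow> real \<Rightarrow> real) \<Rightarrow> bool" where
  "smooth_solution \<omega> \<zeta> \<longleftrightarrow>
     smooth_on (S2 \<times> {0..}) (\<lambda>(x, t). \<zeta> x t) \<and>
     (\<forall>t\<ge>0. zero_mean (\<lambda>x. \<zeta> x t)) \<and>
     (\<forall>t>0. \<exists>\<psi> g.
        (\<forall>r>1. green r (\<lambda>x. \<zeta> x t) \<psi> g) \<and>
        (AE x in sphere_area.
           deriv (\<lambda>s. \<zeta> x s) t
           + rot_J x (grad_S (\<lambda>y. \<omega> * y $ 3) x - g x) \<bullet> grad_S (\<lambda>y. \<zeta> y t) x = 0))"


section \<open>Monotone zonal functions\<close>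

text \<open>The profile is monotone on the open interval only: the poles are a null set, and a real-valued
  monotone profile on the closed interval would have to be bounded.\<close>

definition monotone_zonal :: "(real^3 \<Rightarrow> real) \<Rightarrow> bool" where
  "monotone_zonal f \<longleftrightarrow>
     (\<exists>h :: real \<Rightarrow> real.
        (mono_on {-1<..<1} h \<or> antimono_on {-1<..<1} h) \<and>
        (AE x in sphere_area. f x = h (x $ 3)))"

end

(* A smooth solution conserves the integral of every power of \<zeta>, hence, by
   Weierstrass, of F(\<zeta>) for every continuous F, and also the angular momentum, the integral of
   x_3 \<zeta>. The bracket {A, B} = x . (grad A x grad B) integrates to zero over the sphere, which gives
   the first conservation law; the second needs in addition that the Laplacian of a function is
   orthogonal to its derivative under rotation about the x_3-axis.

   Let \<zeta>' = h(x_3) with h non-decreasing (otherwise change signs). With F' a generalised inverse of h,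
   F is convex and 1-Lipschitz, and D(f) = F(f) - F(\<zeta>') - x_3 (f - \<zeta>') is non-negative, vanishing only
   for f = \<zeta>' wherever h is continuous at x_3. By the conservation laws the integral of D is constant
   along solutions, and it is initially at most twice the L^1 distance to \<zeta>'. Hence initial data
   converging to \<zeta>' force convergence almost everywhere, along a subsequence, at the later times;
   as the L^p norm is conserved too, Scheffe's lemma turns this into convergence in L^p. *)

theory Submission
  imports Defs
begin

section \<open>Functions of class \<open>C\<^sup>k\<close>\<close>

text \<open>The stream function is given only as a W^{2,2} limit of smooth functions and its
  gradient only almost everywhere. Identities involving it are therefore proved for smooth functions
  and carried over by L^2 convergence; the exponent 2 lets products of two convergent factors
  converge. Spherical coordinates degenerate at the poles, so nothing is divided by cos \<theta>:
  brackets with a coordinate function, multiplied by the area element, are differences of two exact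
  derivatives that are continuous on the closed coordinate rectangle, and the other brackets are
  sums of these. Extensions constant along rays turn the tangential calculus into Euclidean calculus
  on space minus the origin. The inverse of h appears because the momentum is the linear invariant
  at hand: for \<zeta>' to be critical for the Casimir minus the momentum, F'(h(s)) = s is needed.
  The argument is by contradiction, with solutions and times both running along a sequence; a
  subsequence then suffices, and \<delta> depends neither on the solution nor on the time.\<close>

lemma Ck_on_SucD:
  assumes "open U" "Ck_on (Suc k) U f" "x \<in> U"
  shows "(f has_derivative frechet_derivative f (at x)) (at x)"
  using assms by (metis Ck_on.simps(2) at_within_open differentiable_on_def frechet_derivative_works)

lemma Ck_on_cong:
  assumes "open U" "\<And>x. x \<in> U \<Longrightarrow> f x = g x" "Ck_on k U f"
  shows "Ck_on k U g"
  using assms(2,3)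
proof (induction k arbitrary: f g)
  case 0
  then show ?case by (simp cong: continuous_on_cong)
next
  case (Suc k)
  have d: "(g has_derivative frechet_derivative f (at x)) (at x)" if "x \<in> U" for x
    using has_derivative_transform_within_open[OF Ck_on_SucD[OF assms(1) Suc.prems(2) that] assms(1) that]
      Suc.prems(1) by auto
  then have "frechet_derivative g (at x) = frechet_derivative f (at x)" if "x \<in> U" for x
    using that by (metis frechet_derivative_at)
  then have "Ck_on k U (\<lambda>x. frechet_derivative g (at x) b)" if "b \<in> Basis" for b
    using Suc.IH[of "\<lambda>x. frechet_derivative f (at x) b"] Suc.prems(2) that by simp
  moreover have "g differentiable_on U"
    using d by (meson differentiable_at_imp_differentiable_on differentiable_def)
  ultimately show ?case by simp
qed

text \<open>The recursion in \<open>Ck_on\<close> speaks of \<open>frechet_derivative\<close>, which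
  is defined by choice. This introduction rule accepts any explicit formula for the derivative on
  \<open>U\<close> and drives most of the closure proofs.\<close>

lemma Ck_on_SucI:
  assumes "open U" and d: "\<And>x. x \<in> U \<Longrightarrow> (f has_derivative f' x) (at x)"
    and c: "\<And>b. b \<in> Basis \<Longrightarrow> Ck_on k U (\<lambda>x. f' x b)"
  shows "Ck_on (Suc k) U f"
proof -
  have "frechet_derivative f (at x) = f' x" if "x \<in> U" for x
    using d[OF that] by (metis frechet_derivative_at)
  then have "Ck_on k U (\<lambda>x. frechet_derivative f (at x) b)" if "b \<in> Basis" for b
    by (intro Ck_on_cong[OF assms(1) _ c[OF that]]) simp
  moreover have "f differentiable_on U"
    using d by (meson differentiable_at_imp_differentiable_on differentiable_def)
  ultimately show ?thesis by simp
qed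

lemma Ck_on_Suc_imp:
  assumes "open U" "Ck_on (Suc k) U f"
  shows "Ck_on k U f"
  using assms(2)
proof (induction k arbitrary: f)
  case 0
  then show ?case by (simp add: differentiable_imp_continuous_on)
next
  case (Suc k)
  show ?case
    by (rule Ck_on_SucI[OF assms(1) Ck_on_SucD[OF assms(1) Suc.prems]])
      (use Suc assms(1) in auto)
qed

lemma Ck_on_imp_continuous_on:
  assumes "open U" "Ck_on k U f"
  shows "continuous_on U f"
  using assms(2) by (induction k) (auto intro: differentiable_imp_continuous_on)

lemma Ck_on_subset:
  assumes "Ck_on k U f" "V \<subseteq> U"
  shows "Ck_on k V f"
  using assms(1)
proof (induction k arbitrary: f)
  case 0
  then show ?case using assms(2) continuous_on_subset by auto
next
  case (Suc k)
  then show ?case using differentiable_on_subset assms(2) by auto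
qed

lemma Ck_on_const: "open U \<Longrightarrow> Ck_on k U (\<lambda>_. c)"
proof (induction k arbitrary: c)
  case (Suc k)
  show ?case
    by (rule Ck_on_SucI[OF Suc.prems has_derivative_const]) (use Suc in auto)
qed auto

lemma Ck_on_linear:
  assumes "open U" "bounded_linear f"
  shows "Ck_on k U f"
proof (cases k)
  case 0
  then show ?thesis using assms(2) by (simp add: linear_continuous_on)
next
  case (Suc m)
  show ?thesis unfolding Suc
    by (rule Ck_on_SucI[OF assms(1) bounded_linear.has_derivative[OF assms(2) has_derivative_ident]])
      (use Ck_on_const assms in auto)
qed

lemma Ck_on_add:
  assumes "open U" "Ck_on k U f" "Ck_on k U g"
  shows "Ck_on k U (\<lambda>x. f x + g x)"
  using assms(2,3)
proof (induction k arbitrary: f g)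
  case 0
  then show ?case by (simp add: continuous_on_add)
next
  case (Suc k)
  show ?case
    by (rule Ck_on_SucI[OF assms(1) has_derivative_add
          [OF Ck_on_SucD[OF assms(1) Suc.prems(1)] Ck_on_SucD[OF assms(1) Suc.prems(2)]]])
      (use Suc assms(1) in auto)
qed

lemma Ck_on_mult:
  assumes "open U" "Ck_on k U f" "Ck_on k U g"
  shows "Ck_on k U (\<lambda>x. f x * g x)"
  using assms(2,3)
proof (induction k arbitrary: f g)
  case 0
  then show ?case by (simp add: continuous_on_mult)
next
  case (Suc k)
  note [simp] = assms(1)
  \<comment> \<open>The product rule multiplies derivatives of class k by undifferentiated factors
    of class k + 1, so the latter are lowered by \<open>Ck_on_Suc_imp\<close>.\<close>
  show ?case
    by (rule Ck_on_SucI[OF assms(1) has_derivative_mult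
          [OF Ck_on_SucD[OF assms(1) Suc.prems(1)] Ck_on_SucD[OF assms(1) Suc.prems(2)]]])
      (use Suc Ck_on_Suc_imp[OF assms(1)] in \<open>auto intro!: Ck_on_add Suc.IH simp del: Ck_on.simps(2)\<close>, simp_all)
qed

lemma Ck_on_sum:
  assumes "open U" "\<And>i. i \<in> I \<Longrightarrow> Ck_on k U (f i)"
  shows "Ck_on k U (\<lambda>x. \<Sum>i\<in>I. f i x)"
  using assms(2)
  by (induction I rule: infinite_finite_induct) (auto intro: Ck_on_add Ck_on_const assms(1))

lemma Ck_on_power: "open U \<Longrightarrow> Ck_on k U f \<Longrightarrow> Ck_on k U (\<lambda>x. f x ^ n)"
  by (induction n) (auto intro: Ck_on_const Ck_on_mult)

lemma Ck_on_diff: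
  assumes "open U" "Ck_on k U f" "Ck_on k U g"
  shows "Ck_on k U (\<lambda>x. f x - g x)"
  using Ck_on_add[OF assms(1,2) Ck_on_mult[OF assms(1) Ck_on_const[OF assms(1), of k "-1"] assms(3)]]
  by simp

lemma Ck_on_coord: "open U \<Longrightarrow> Ck_on k U (\<lambda>x::real^'n. x $ i)"
  by (intro Ck_on_linear bounded_linear_vec_nth)

lemmas Ck_on_intros = Ck_on_add Ck_on_diff Ck_on_mult Ck_on_power Ck_on_coord

text \<open>\<open>Ck_on\<close> covers real-valued functions only, so the inner map enters through
  its components. The chain rule turns each partial derivative into a sum of products, and the
  induction hypothesis is applied to the partial derivatives of \<open>f\<close>.\<close>

lemma Ck_on_compose:
  fixes g :: "'a::euclidean_space \<Rightarrow> 'b::euclidean_space"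
  assumes "open U" "open V" "\<And>x. x \<in> U \<Longrightarrow> g x \<in> V"
    and "Ck_on k V f" "\<And>b. b \<in> Basis \<Longrightarrow> Ck_on k U (\<lambda>x. g x \<bullet> b)"
  shows "Ck_on k U (\<lambda>x. f (g x))"
  using assms(4,5)
proof (induction k arbitrary: f)
  case 0
  have "continuous_on U g"
    using 0 by (auto intro: continuous_on_componentwise[THEN iffD2])
  then show ?case
    using 0 assms(3) by (auto intro: continuous_on_compose2[of V f])
next
  case (Suc k)
  define g' where "g' x h = (\<Sum>j\<in>Basis. frechet_derivative (\<lambda>x. g x \<bullet> j) (at x) h *\<^sub>R j)" for x h
  have g': "(g has_derivative g' x) (at x)" if "x \<in> U" for x
  proof -
    have "((\<lambda>y. \<Sum>j\<in>Basis. (g y \<bullet> j) *\<^sub>R j) has_derivative g' x) (at x)"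
      unfolding g'_def
      by (intro has_derivative_sum has_derivative_scaleR_left Ck_on_SucD[OF assms(1) Suc.prems(2)] that)
    then show ?thesis by (simp add: euclidean_representation)
  qed
  show ?case
  proof (rule Ck_on_SucI[OF assms(1)])
    show "((\<lambda>x. f (g x)) has_derivative (\<lambda>h. frechet_derivative f (at (g x)) (g' x h))) (at x)"
      if "x \<in> U" for x
      by (rule has_derivative_compose[OF g'[OF that]])
        (use Ck_on_SucD[OF assms(2) Suc.prems(1)] assms(3) that in auto)
    fix b :: 'a assume b: "b \<in> Basis"
    have ck: "Ck_on k U (\<lambda>x. \<Sum>j\<in>Basis. frechet_derivative (\<lambda>x. g x \<bullet> j) (at x) b * frechet_derivative f (at (g x)) j)"
    proof (intro Ck_on_sum Ck_on_mult assms(1))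
      fix j :: 'b assume j: "j \<in> Basis"
      show "Ck_on k U (\<lambda>x. frechet_derivative (\<lambda>x. g x \<bullet> j) (at x) b)"
        using Suc.prems(2)[OF j] b by simp
      show "Ck_on k U (\<lambda>x. frechet_derivative f (at (g x)) j)"
        by (rule Suc.IH) (use Suc.prems(1) j in simp, rule Ck_on_Suc_imp[OF assms(1) Suc.prems(2)])
    qed
    have eq: "frechet_derivative f (at (g x)) (g' x b) =
        (\<Sum>j\<in>Basis. frechet_derivative (\<lambda>x. g x \<bullet> j) (at x) b * frechet_derivative f (at (g x)) j)"
      if "x \<in> U" for x
    proof -
      interpret linear "frechet_derivative f (at (g x))"
        using Ck_on_SucD[OF assms(2) Suc.prems(1) assms(3)[OF that]] has_derivative_linear by blast
      show ?thesis by (simp add: g'_def sum scaleR)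
    qed
    show "Ck_on k U (\<lambda>x. frechet_derivative f (at (g x)) (g' x b))"
      by (rule Ck_on_cong[OF assms(1) _ ck]) (simp add: eq)
  qed
qed

section \<open>Smoothness of the radial projection and of functions on the sphere\<close>

lemma Ck_on_powr: "Ck_on k {0<..} (\<lambda>s::real. s powr a)"
proof (induction k arbitrary: a)
  case 0
  then show ?case by (auto intro!: continuous_intros)
next
  case (Suc k)
  show ?case
  proof (rule Ck_on_SucI)
    show "((\<lambda>s. s powr a) has_derivative (\<lambda>h. h * (a * x powr (a - 1)))) (at x)" if "x \<in> {0<..}" for x
      using has_real_derivative_powr[of x a] that
      by (simp add: has_field_derivative_def mult_commute_abs mult.commute)
    show "Ck_on k {0<..} (\<lambda>x. b * (a * x powr (a - 1)))" for b
      by (intro Ck_on_mult Ck_on_const Suc.IH) auto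
  qed auto
qed

text \<open>Away from the origin \<open>sgn x\<close> is x times (x \<bullet> x) powr (-1/2), a
  product of maps already known to be smooth.\<close>

lemma Ck_on_sgn:
  fixes b :: "'a::euclidean_space"
  shows "Ck_on k (-{0}) (\<lambda>x::'a. sgn x \<bullet> b)"
proof -
  have sq: "Ck_on k (-{0}) (\<lambda>x::'a. x \<bullet> x)"
    apply (subst euclidean_inner)
    by (intro Ck_on_sum Ck_on_mult Ck_on_linear bounded_linear_inner_left) auto
  have "Ck_on k (-{0}) (\<lambda>x::'a. (x \<bullet> x) powr (-1/2))"
    by (rule Ck_on_compose[where V = "{0<..}" and f = "\<lambda>s. s powr (-1/2)"]) (auto intro: Ck_on_powr sq)
  then have "Ck_on k (-{0}) (\<lambda>x::'a. (x \<bullet> b) * (x \<bullet> x) powr (-1/2))"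
    by (intro Ck_on_mult[OF _ Ck_on_linear[OF _ bounded_linear_inner_left]]) auto
  moreover have "(x \<bullet> b) * (x \<bullet> x) powr (-1/2) = sgn x \<bullet> b" for x :: 'a
  proof (cases "x = 0")
    case False
    then have "(x \<bullet> x) powr (-1/2) = (norm x powr 2) powr (-1/2)"
      by (simp add: dot_square_norm)
    also have "\<dots> = 1 / norm x"
      using False unfolding powr_powr by (simp add: powr_minus_divide)
    finally have "(x \<bullet> x) powr (-1/2) = 1 / norm x" .
    then show ?thesis by (simp add: sgn_div_norm inverse_eq_divide)
  qed simp
  ultimately show ?thesis by simp
qed

text \<open>The neighbourhood behind \<open>smooth_on\<close> varies with the function. Composing
  with the radial projection gives an extension whose domain is the same for all functions; it is
  the one that \<open>grad_S\<close> and \<open>hess_S\<close> differentiate.\<close>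

lemma smooth_on_imp_Ck_on_sgn:
  fixes w :: "'a::euclidean_space \<Rightarrow> real"
  assumes "smooth_on (sphere 0 1) w"
  shows "Ck_on k (-{0}) (\<lambda>y. w (sgn y))"
proof -
  obtain U F where U: "open U" "sphere 0 1 \<subseteq> U" "Ck_on k U F" "\<And>x. x \<in> sphere 0 1 \<Longrightarrow> F x = w x"
    using assms unfolding smooth_on_def by metis
  have s: "sgn y \<in> sphere 0 1" if "y \<in> -{0}" for y :: 'a
    using that by (simp add: norm_sgn)
  have "Ck_on k (-{0}) (\<lambda>y. F (sgn y))"
    by (rule Ck_on_compose[OF _ U(1) _ U(3)]) (use s U(2) Ck_on_sgn in auto)
  then show ?thesis
    by (rule Ck_on_cong[rotated 2]) (use s U(4) in auto)
qed

lemma smooth_on_time_slice: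
  fixes \<zeta> :: "'a::euclidean_space \<Rightarrow> real \<Rightarrow> real"
  assumes "smooth_on (S \<times> T) (\<lambda>(x, t). \<zeta> x t)" "t \<in> T"
  shows "smooth_on S (\<lambda>x. \<zeta> x t)"
proof -
  obtain U F where U: "open U" "S \<times> T \<subseteq> U" "\<And>k. Ck_on k U F"
    "\<forall>y\<in>S \<times> T. F y = (case y of (x, t) \<Rightarrow> \<zeta> x t)"
    using assms(1) unfolding smooth_on_def by blast
  define V where "V = (\<lambda>x. (x, t)) -` U"
  have V: "open V"
    unfolding V_def by (intro open_vimage U continuous_intros)
  have "Ck_on k V (\<lambda>x. F (x, t))" for k
  proof (rule Ck_on_compose[OF V U(1) _ U(3)])
    fix b :: "'a \<times> real"
    have "Ck_on k V (\<lambda>x. x \<bullet> fst b + t * snd b)"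
      by (intro Ck_on_add Ck_on_linear[OF V bounded_linear_inner_left] Ck_on_const V)
    then show "Ck_on k V (\<lambda>x. (x, t) \<bullet> b)"
      by (simp add: inner_prod_def)
  qed (simp add: V_def)
  moreover have "S \<subseteq> V" using U(2) assms(2) by (auto simp: V_def)
  moreover have "\<forall>x\<in>S. F (x, t) = \<zeta> x t" using U(4) assms(2) by auto
  ultimately show ?thesis
    unfolding smooth_on_def using V by blast
qed

section \<open>Symmetry of second derivatives and the Euclidean gradient\<close>

text \<open>The mean value theorem is used twice: along \<open>a\<close> for the increment of
  \<open>f\<close> in direction \<open>b\<close>, then along \<open>b\<close> for the partial
  derivative in direction \<open>a\<close>. The bound on h keeps the parallelogram inside the
  ball.\<close>

lemma second_difference_mean_value:
  fixes f :: "'a::euclidean_space \<Rightarrow> real"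
  assumes "Ck_on 2 (ball x r) f" "a \<in> Basis" "b \<in> Basis" "0 < h" "2 * h < r"
  obtains y where "y \<in> ball x r"
    "f (x + h *\<^sub>R a + h *\<^sub>R b) - f (x + h *\<^sub>R a) - f (x + h *\<^sub>R b) + f x
      = h * h * frechet_derivative (\<lambda>z. frechet_derivative f (at z) a) (at y) b"
proof -
  let ?B = "ball x r"
  let ?Da = "\<lambda>z. frechet_derivative f (at z) a"
  have D: "(f has_derivative frechet_derivative f (at z)) (at z)" if "z \<in> ?B" for z
    using Ck_on_SucD[of ?B 1 f z] assms(1) that by (simp add: numeral_2_eq_2)
  have Da: "(?Da has_derivative frechet_derivative ?Da (at z)) (at z)" if "z \<in> ?B" for z
    using Ck_on_SucD[of ?B 0 ?Da z] assms that by (simp add: numeral_2_eq_2)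
  have mem: "x + s *\<^sub>R a + t *\<^sub>R b \<in> ?B" if "0 \<le> s" "s \<le> h" "0 \<le> t" "t \<le> h" for s t
  proof -
    have "norm (s *\<^sub>R a + t *\<^sub>R b) \<le> s + t"
      using norm_triangle_ineq[of "s *\<^sub>R a" "t *\<^sub>R b"] assms that by simp
    then show ?thesis
      using that assms by (simp add: dist_norm norm_minus_commute algebra_simps)
  qed
  have line: "((\<lambda>s. F (p + s *\<^sub>R v)) has_real_derivative frechet_derivative F (at (p + s *\<^sub>R v)) v) (at s)"
    if "(F has_derivative frechet_derivative F (at (p + s *\<^sub>R v))) (at (p + s *\<^sub>R v))"
    for F :: "'a \<Rightarrow> real" and p v s
  proof -
    interpret linear "frechet_derivative F (at (p + s *\<^sub>R v))"
      using that has_derivative_linear by blast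
    have "((\<lambda>s. F (p + s *\<^sub>R v)) has_derivative (\<lambda>k. frechet_derivative F (at (p + s *\<^sub>R v)) (k *\<^sub>R v))) (at s)"
      by (rule has_derivative_compose[of "\<lambda>s. p + s *\<^sub>R v" "\<lambda>k. k *\<^sub>R v" s UNIV F])
        (use that in \<open>auto intro!: derivative_eq_intros\<close>)
    then show ?thesis
      by (simp add: has_field_derivative_def scaleR mult_commute_abs)
  qed
  have 1: "((\<lambda>s. f (x + h *\<^sub>R b + s *\<^sub>R a) - f (x + s *\<^sub>R a)) has_real_derivative
      ?Da (x + h *\<^sub>R b + s *\<^sub>R a) - ?Da (x + s *\<^sub>R a)) (at s)" if "0 \<le> s" "s \<le> h" for s
    using mem[of s h] mem[of s 0] that assms(4)
    by (intro DERIV_diff line D) (simp_all add: algebra_simps)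
  obtain s where s: "0 < s" "s < h" and
    "(f (x + h *\<^sub>R b + h *\<^sub>R a) - f (x + h *\<^sub>R a)) - (f (x + h *\<^sub>R b + 0 *\<^sub>R a) - f (x + 0 *\<^sub>R a))
      = (h - 0) * (?Da (x + h *\<^sub>R b + s *\<^sub>R a) - ?Da (x + s *\<^sub>R a))"
    using MVT2[OF assms(4) 1] by auto
  then have e1: "f (x + h *\<^sub>R a + h *\<^sub>R b) - f (x + h *\<^sub>R a) - f (x + h *\<^sub>R b) + f x
      = h * (?Da (x + s *\<^sub>R a + h *\<^sub>R b) - ?Da (x + s *\<^sub>R a))"
    by (simp add: algebra_simps)
  have 2: "((\<lambda>t. ?Da (x + s *\<^sub>R a + t *\<^sub>R b)) has_real_derivative
      frechet_derivative ?Da (at (x + s *\<^sub>R a + t *\<^sub>R b)) b) (at t)" if "0 \<le> t" "t \<le> h" for t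
    using mem[of s t] that s by (intro line Da) simp
  obtain t where t: "0 < t" "t < h" and
    "?Da (x + s *\<^sub>R a + h *\<^sub>R b) - ?Da (x + s *\<^sub>R a + 0 *\<^sub>R b)
      = (h - 0) * frechet_derivative ?Da (at (x + s *\<^sub>R a + t *\<^sub>R b)) b"
    using MVT2[OF assms(4) 2] by auto
  with e1 show thesis
    by (intro that[OF mem[of s t]]) (use s t in auto)
qed

text \<open>The second difference is symmetric in \<open>a\<close> and \<open>b\<close>, so the two
  mixed derivatives agree at some pair of points near x; continuity brings both points to x.\<close>

lemma second_derivative_symmetric:
  fixes f :: "'a::euclidean_space \<Rightarrow> real"
  assumes "open U" "Ck_on 2 U f" "x \<in> U" and ab: "a \<in> Basis" "b \<in> Basis"
  shows "frechet_derivative (\<lambda>z. frechet_derivative f (at z) a) (at x) b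
    = frechet_derivative (\<lambda>z. frechet_derivative f (at z) b) (at x) a" (is "?P x = ?Q x")
proof (rule ccontr)
  assume ne: "?P x \<noteq> ?Q x"
  \<comment> \<open>Half the gap: two errors smaller than this cannot bridge it.\<close>
  define e where "e = \<bar>?P x - ?Q x\<bar> / 2"
  have e: "0 < e" using ne by (simp add: e_def)
  have "continuous_on U ?P" "continuous_on U ?Q"
    using assms by (simp_all add: numeral_2_eq_2)
  then have "isCont ?P x" "isCont ?Q x"
    using assms(1,3) by (simp_all add: continuous_on_eq_continuous_at)
  then obtain d1 d2 where d: "0 < d1" "0 < d2"
    "\<And>y. dist y x < d1 \<Longrightarrow> dist (?P y) (?P x) < e"
    "\<And>y. dist y x < d2 \<Longrightarrow> dist (?Q y) (?Q x) < e"
    using e unfolding continuous_at_eps_delta by metis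
  obtain d3 where d3: "0 < d3" "ball x d3 \<subseteq> U"
    using assms(1,3) open_contains_ball by blast
  define r where "r = min d3 (min d1 d2)"
  have r: "0 < r" "r \<le> d1" "r \<le> d2" "r \<le> d3" using d d3 by (auto simp: r_def)
  have C: "Ck_on 2 (ball x r) f"
    using assms(2) by (rule Ck_on_subset) (use d3 r in auto)
  have h: "0 < r / 3" "2 * (r / 3) < r" using r by auto
  obtain y where y: "y \<in> ball x r" "f (x + (r/3) *\<^sub>R a + (r/3) *\<^sub>R b) - f (x + (r/3) *\<^sub>R a) - f (x + (r/3) *\<^sub>R b) + f x
      = (r/3) * (r/3) * ?P y"
    by (rule second_difference_mean_value[OF C ab h])
  obtain y' where y': "y' \<in> ball x r" "f (x + (r/3) *\<^sub>R b + (r/3) *\<^sub>R a) - f (x + (r/3) *\<^sub>R b) - f (x + (r/3) *\<^sub>R a) + f x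
      = (r/3) * (r/3) * ?Q y'"
    by (rule second_difference_mean_value[OF C ab(2,1) h])
  have "(r/3) * (r/3) * ?P y = (r/3) * (r/3) * ?Q y'"
    unfolding y(2)[symmetric] y'(2)[symmetric] by (simp add: algebra_simps)
  then have "?P y = ?Q y'" using h by simp
  moreover have "dist (?P y) (?P x) < e" "dist (?Q y') (?Q x) < e"
    using d(3)[of y] d(4)[of y'] y(1) y'(1) r by (auto simp: dist_commute)
  ultimately show False
    unfolding e_def dist_real_def by argo
qed

definition grad3 :: "(real^3 \<Rightarrow> real) \<Rightarrow> real^3 \<Rightarrow> real^3" where
  "grad3 f x = (\<chi> i. pderiv3 i f x)"

lemma grad3_nth [simp]: "grad3 f x $ i = pderiv3 i f x"
  by (simp add: grad3_def)

lemma grad_S_eq: "grad_S u = grad3 (\<lambda>y. u (sgn y))"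
  by (rule ext) (simp add: grad_S_def grad3_def)

lemma has_derivative_grad3:
  assumes "f differentiable (at x)"
  shows "(f has_derivative (\<lambda>h. grad3 f x \<bullet> h)) (at x)"
proof -
  have d: "(f has_derivative frechet_derivative f (at x)) (at x)"
    using assms by (simp add: frechet_derivative_works)
  interpret linear "frechet_derivative f (at x)"
    using d has_derivative_linear by blast
  have "frechet_derivative f (at x) h = grad3 f x \<bullet> h" for h
  proof -
    have "frechet_derivative f (at x) (\<Sum>i\<in>UNIV. (h $ i) *\<^sub>R axis i 1) = grad3 f x \<bullet> h"
      by (simp add: sum scaleR inner_vec_def pderiv3_def mult.commute)
    then show ?thesis
      using basis_expansion[of h] by (simp add: scalar_mult_eq_scaleR)
  qed
  then show ?thesis using d by (metis (no_types, lifting) ext)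
qed

lemma grad3_unique:
  assumes "(f has_derivative (\<lambda>h. v \<bullet> h)) (at x)"
  shows "grad3 f x = v"
proof -
  have "frechet_derivative f (at x) = (\<lambda>h. v \<bullet> h)"
    using assms by (metis frechet_derivative_at)
  then show ?thesis by (simp add: vec_eq_iff pderiv3_def inner_axis)
qed

lemma Ck_on_pderiv3: "Ck_on (Suc k) U f \<Longrightarrow> Ck_on k U (pderiv3 i f)"
  by (simp add: pderiv3_def[abs_def] axis_in_Basis_iff)

lemma Ck_on_differentiable_at:
  assumes "open U" "Ck_on (Suc k) U f" "x \<in> U"
  shows "f differentiable (at x)"
  using Ck_on_SucD[OF assms] by (auto simp: differentiable_def)

lemma pderiv3_commute:
  assumes "open U" "Ck_on 2 U f" "x \<in> U"
  shows "pderiv3 i (pderiv3 j f) x = pderiv3 j (pderiv3 i f) x"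
  unfolding pderiv3_def[abs_def]
  by (rule second_derivative_symmetric[OF assms]) (auto simp: axis_in_Basis_iff)

lemma grad3_mult:
  assumes "f differentiable (at x)" "g differentiable (at x)"
  shows "grad3 (\<lambda>x. f x * g x) x = f x *\<^sub>R grad3 g x + g x *\<^sub>R grad3 f x"
  by (rule grad3_unique)
    (rule has_derivative_eq_rhs[OF has_derivative_mult[OF has_derivative_grad3[OF assms(1)] has_derivative_grad3[OF assms(2)]]],
      auto simp: inner_add_left)

lemma grad3_add:
  assumes "f differentiable (at x)" "g differentiable (at x)"
  shows "grad3 (\<lambda>x. f x + g x) x = grad3 f x + grad3 g x"
  by (rule grad3_unique)
    (rule has_derivative_eq_rhs[OF has_derivative_add[OF has_derivative_grad3[OF assms(1)] has_derivative_grad3[OF assms(2)]]],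
      auto simp: inner_add_left)

lemma grad3_diff:
  assumes "f differentiable (at x)" "g differentiable (at x)"
  shows "grad3 (\<lambda>x. f x - g x) x = grad3 f x - grad3 g x"
  by (rule grad3_unique)
    (rule has_derivative_eq_rhs[OF has_derivative_diff[OF has_derivative_grad3[OF assms(1)] has_derivative_grad3[OF assms(2)]]],
      auto simp: inner_diff_left)

lemma grad3_coord: "grad3 (\<lambda>x. x $ i) x = axis i 1"
  using bounded_linear.has_derivative[OF bounded_linear_vec_nth has_derivative_ident]
  by (intro grad3_unique) (simp add: inner_axis')

lemma grad3_power:
  assumes "f differentiable (at x)"
  shows "grad3 (\<lambda>x. f x ^ n) x = (of_nat n * f x ^ (n - 1)) *\<^sub>R grad3 f x"
  by (rule grad3_unique)
    (rule has_derivative_eq_rhs[OF has_derivative_power[OF has_derivative_grad3[OF assms]]],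
     auto)

lemma continuous_on_grad3:
  assumes "open U" "Ck_on (Suc k) U f"
  shows "continuous_on U (grad3 f)"
  using Ck_on_imp_continuous_on[OF assms(1) Ck_on_pderiv3[OF assms(2)]]
  by (subst continuous_on_componentwise) (auto simp: Basis_vec_def inner_axis)

section \<open>Integration over the sphere\<close>

abbreviation rect :: "(real \<times> real) set" where
  "rect \<equiv> cbox (0, -(pi/2)) (2*pi, pi/2)"

lemma rect_eq: "rect = {0..2*pi} \<times> {-(pi/2)..pi/2}"
  by (auto simp: cbox_Pair_eq)

lemma spherical_nth [simp]:
  "spherical (\<phi>, \<theta>) $ 1 = cos \<theta> * cos \<phi>"
  "spherical (\<phi>, \<theta>) $ 2 = cos \<theta> * sin \<phi>"
  "spherical (\<phi>, \<theta>) $ 3 = sin \<theta>"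
  by (simp_all add: spherical_def)

lemma norm_spherical [simp]: "norm (spherical z) = 1"
proof -
  obtain \<phi> \<theta> where z: "z = (\<phi>, \<theta>)" by fastforce
  have "norm (spherical z) ^ 2 = (cos \<theta>)^2 * ((cos \<phi>)^2 + (sin \<phi>)^2) + (sin \<theta>)^2"
    unfolding z power2_norm_eq_inner inner_vec_def sum_3 spherical_nth inner_real_def
    by algebra
  also have "\<dots> = 1" by simp
  finally show ?thesis by (metis abs_norm_cancel abs_square_eq_1)
qed

lemma spherical_neq_0 [simp]: "spherical z \<noteq> 0"
  using norm_spherical[of z] by (metis norm_zero zero_neq_one)

lemma spherical_in_S2: "spherical z \<in> S2"
  by simp

lemma vector_3_eq: "vector [x, y, z] = x *\<^sub>R axis 1 1 + y *\<^sub>R axis 2 1 + z *\<^sub>R (axis 3 1 :: real^3)"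
  by (simp add: vec_eq_iff forall_3 axis_def)

lemma continuous_on_spherical [continuous_intros]: "continuous_on A spherical"
  unfolding spherical_def vector_3_eq case_prod_beta by (intro continuous_intros)

lemma measurable_spherical [measurable]: "spherical \<in> measurable borel (restrict_space borel S2)"
  by (rule measurable_restrict_space2)
    (auto intro!: borel_measurable_continuous_onI continuous_on_spherical simp: space_borel)

definition sphere_dens :: "real \<times> real \<Rightarrow> real" where
  "sphere_dens = (\<lambda>(\<phi>, \<theta>). cos \<theta> * indicator rect (\<phi>, \<theta>))"

lemma sphere_dens_nonneg: "0 \<le> sphere_dens z"
  by (cases z) (auto simp: sphere_dens_def rect_eq indicator_def intro!: cos_ge_zero)

lemma sphere_dens_measurable [measurable]: "sphere_dens \<in> borel_measurable borel"
proof -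
  have "(\<lambda>z::real \<times> real. cos (snd z) * indicator rect z) \<in> borel_measurable borel"
    by (intro borel_measurable_times borel_measurable_indicator
        borel_measurable_continuous_onI continuous_intros) auto
  then show ?thesis by (simp add: sphere_dens_def case_prod_beta')
qed

lemma sphere_area_eq:
  "sphere_area = distr (density lborel (\<lambda>z. ennreal (sphere_dens z))) (restrict_space borel S2) spherical"
  unfolding sphere_area_def sphere_dens_def rect_eq by (simp add: case_prod_beta')

lemma sets_sphere_area [simp, measurable_cong]: "sets sphere_area = sets (restrict_space borel S2)"
  by (simp add: sphere_area_def)

lemma space_sphere_area [simp]: "space sphere_area = S2"
  by (simp add: sphere_area_def space_restrict_space)

lemma AE_sphere_area_iff:
  assumes "{x \<in> S2. P x} \<in> sets (restrict_space borel S2)"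
  shows "(AE x in sphere_area. P x) \<longleftrightarrow> (AE z in lborel. sphere_dens z > 0 \<longrightarrow> P (spherical z))"
  unfolding sphere_area_eq using assms
  by (subst AE_distr_iff) (auto simp: AE_density space_restrict_space)

text \<open>The passage to the integral over a closed rectangle makes Fubini for continuous
  functions, the fundamental theorem of calculus and the Leibniz rule available.\<close>

lemma
  fixes f :: "real^3 \<Rightarrow> 'b::euclidean_space"
  assumes "continuous_on S2 f"
  shows borel_measurable_continuous_S2: "f \<in> borel_measurable sphere_area"
    and integrable_continuous_S2: "integrable sphere_area f"
    and integral_continuous_S2:
      "integral\<^sup>L sphere_area f = integral rect (\<lambda>z. cos (snd z) *\<^sub>R f (spherical z))"
proof -
  have m: "f \<in> borel_measurable (restrict_space borel S2)"
    by (rule borel_measurable_continuous_on_restrict[OF assms])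
  then show "f \<in> borel_measurable sphere_area"
    by (simp cong: measurable_cong_sets)
  have mf: "(\<lambda>z. f (spherical z)) \<in> borel_measurable borel"
    using measurable_comp[OF measurable_spherical m] by (simp add: comp_def)
  have c: "continuous_on rect (\<lambda>z. cos (snd z) *\<^sub>R f (spherical z))"
    by (intro continuous_intros continuous_on_compose2[OF assms]) auto
  have eq: "sphere_dens z *\<^sub>R f (spherical z) = indicator rect z *\<^sub>R (cos (snd z) *\<^sub>R f (spherical z))" for z
    by (cases z) (simp add: sphere_dens_def)
  have si: "set_integrable lborel rect (\<lambda>z. cos (snd z) *\<^sub>R f (spherical z))"
    unfolding set_integrable_def
    by (rule borel_integrable_compact[OF compact_cbox c])
  show "integrable sphere_area f"
    unfolding sphere_area_eq using si mf m
    by (subst integrable_distr_eq) (auto simp: integrable_density sphere_dens_nonneg eq set_integrable_def)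
  have "integral\<^sup>L sphere_area f = (LINT z:rect|lborel. cos (snd z) *\<^sub>R f (spherical z))"
    unfolding sphere_area_eq using mf m
    by (subst integral_distr) (auto simp: integral_density sphere_dens_nonneg eq set_lebesgue_integral_def)
  then show "integral\<^sup>L sphere_area f = integral rect (\<lambda>z. cos (snd z) *\<^sub>R f (spherical z))"
    using set_borel_integral_eq_integral(2)[OF si] by simp
qed

interpretation sphere: finite_measure sphere_area
proof
  have "integrable sphere_area (\<lambda>_. 1::real)"
    by (rule integrable_continuous_S2) auto
  then show "emeasure sphere_area (space sphere_area) \<noteq> \<infinity>"
    by (auto simp: integrable_iff_bounded)
qed

lemma continuous_on_S2_punctured:
  fixes f :: "real^3 \<Rightarrow> 'b::topological_space"
  shows "continuous_on (-{0}) f \<Longrightarrow> continuous_on S2 f"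
  by (erule continuous_on_subset) auto

section \<open>The coordinate tangent frame and integration by parts\<close>

definition sph_phi :: "real \<times> real \<Rightarrow> real^3" where
  "sph_phi = (\<lambda>(\<phi>, \<theta>). vector [- cos \<theta> * sin \<phi>, cos \<theta> * cos \<phi>, 0])"

definition sph_theta :: "real \<times> real \<Rightarrow> real^3" where
  "sph_theta = (\<lambda>(\<phi>, \<theta>). vector [- sin \<theta> * cos \<phi>, - sin \<theta> * sin \<phi>, cos \<theta>])"

definition sph_phi_theta :: "real \<times> real \<Rightarrow> real^3" where
  "sph_phi_theta = (\<lambda>(\<phi>, \<theta>). vector [sin \<theta> * sin \<phi>, - sin \<theta> * cos \<phi>, 0])"

lemmas sph_defs = spherical_def sph_phi_def sph_theta_def sph_phi_theta_def

lemma has_derivative_vec3: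
  assumes "(f1 has_real_derivative d1) F" "(f2 has_real_derivative d2) F" "(f3 has_real_derivative d3) F"
  shows "((\<lambda>t. vector [f1 t, f2 t, f3 t] :: real^3) has_vector_derivative vector [d1, d2, d3]) F"
  unfolding vector_3_eq using assms
  by (intro has_vector_derivative_add)
    (auto intro: bounded_linear.has_vector_derivative[OF bounded_linear_scaleR_left]
      simp: has_real_derivative_iff_has_vector_derivative)

lemma sph_derivs:
  shows "((\<lambda>s. spherical (s, \<theta>)) has_vector_derivative sph_phi (\<phi>, \<theta>)) (at \<phi> within A)"
    "((\<lambda>s. spherical (\<phi>, s)) has_vector_derivative sph_theta (\<phi>, \<theta>)) (at \<theta> within B)"
    "((\<lambda>s. sph_theta (s, \<theta>)) has_vector_derivative sph_phi_theta (\<phi>, \<theta>)) (at \<phi> within A)"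
    "((\<lambda>s. sph_phi (\<phi>, s)) has_vector_derivative sph_phi_theta (\<phi>, \<theta>)) (at \<theta> within B)"
  unfolding sph_defs case_prod_conv
  by (rule has_derivative_vec3; auto intro!: derivative_eq_intros)+

lemma continuous_on_sph:
  "continuous_on A sph_phi" "continuous_on A sph_theta" "continuous_on A sph_phi_theta"
  unfolding sph_defs vector_3_eq case_prod_beta by (intro continuous_intros)+

text \<open>Uses \<open>cos \<theta> \<cdot> s = s\<^sub>\<phi> \<times> s\<^sub>\<theta>\<close> for the position vector \<open>s\<close>.\<close>

lemma spherical_triple:
  "cos \<theta> * (spherical (\<phi>, \<theta>) \<bullet> cross3 c v) =
    (c \<bullet> sph_phi (\<phi>, \<theta>)) * (v \<bullet> sph_theta (\<phi>, \<theta>)) - (c \<bullet> sph_theta (\<phi>, \<theta>)) * (v \<bullet> sph_phi (\<phi>, \<theta>))"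
proof -
  have "sin \<theta> * sin \<theta> = 1 - cos \<theta> * cos \<theta>" "sin \<phi> * sin \<phi> = 1 - cos \<phi> * cos \<phi>"
    using sin_cos_squared_add3[of \<theta>] sin_cos_squared_add3[of \<phi>] by linarith+
  then show ?thesis
    unfolding sph_defs case_prod_conv cross3_def inner_vec_def sum_3 vector_3 inner_real_def
    by algebra
qed

text \<open>In coordinates the integrand is the difference of the \<theta>-derivative of (c
  \<bullet> \<open>sph_phi\<close>) b and the \<phi>-derivative of (c \<bullet>
  \<open>sph_theta\<close>) b: the mixed derivative of the position vector occurs in both and
  cancels. Each of the two integrates to zero.\<close>

lemma integral_bracket_linear:
  assumes B: "Ck_on 1 (-{0}) B"
  shows "(\<integral>x. x \<bullet> cross3 c (grad3 B x) \<partial>sphere_area) = 0"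
proof -
  define b where "b = (\<lambda>z. B (spherical z))"
  define v where "v = (\<lambda>z. grad3 B (spherical z))"
  have B': "Ck_on (Suc 0) (-{0}) B" using B by simp
  have cg: "continuous_on S2 (grad3 B)"
    by (rule continuous_on_S2_punctured[OF continuous_on_grad3[OF _ B']]) auto
  have cv: "continuous_on A v" for A
    unfolding v_def by (rule continuous_on_compose2[OF cg continuous_on_spherical]) auto
  have "continuous_on S2 B"
    using Ck_on_imp_continuous_on[OF _ B] by (intro continuous_on_S2_punctured) auto
  then have cb: "continuous_on A b" for A
    unfolding b_def by (rule continuous_on_compose2[OF _ continuous_on_spherical]) auto
  have D: "(B has_derivative (\<lambda>h. v z \<bullet> h)) (at (spherical z))" for z
    unfolding v_def
    by (intro has_derivative_grad3 Ck_on_differentiable_at[OF _ B'])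
      auto
  have chain: "((\<lambda>s. B (g s)) has_real_derivative v z \<bullet> g') (at t within A)"
    if "(g has_vector_derivative g') (at t within A)" "g t = spherical z" for g g' t z A
    using has_derivative_compose[OF that(1)[unfolded has_vector_derivative_def], of B "\<lambda>h. v z \<bullet> h"] D[of z] that(2)
    by (simp add: has_field_derivative_def mult_commute_abs)
  have db: "((\<lambda>s. b (s, \<theta>)) has_real_derivative v (\<phi>, \<theta>) \<bullet> sph_phi (\<phi>, \<theta>)) (at \<phi> within A)"
      "((\<lambda>s. b (\<phi>, s)) has_real_derivative v (\<phi>, \<theta>) \<bullet> sph_theta (\<phi>, \<theta>)) (at \<theta> within A)" for \<phi> \<theta> A
    unfolding b_def by (rule chain[OF sph_derivs(1)] chain[OF sph_derivs(2)]; simp)+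
  have dc: "((\<lambda>s. c \<bullet> g s) has_real_derivative c \<bullet> g') (at t within A)"
    if "(g has_vector_derivative g') (at t within A)" for g :: "real \<Rightarrow> real^3" and g' t A
    using bounded_linear.has_vector_derivative[OF bounded_linear_inner_right that, of c]
    by (simp add: has_real_derivative_iff_has_vector_derivative)
  define G1 where "G1 = (\<lambda>z. (c \<bullet> sph_phi_theta z) * b z + (c \<bullet> sph_phi z) * (v z \<bullet> sph_theta z))"
  define G2 where "G2 = (\<lambda>z. (c \<bullet> sph_phi_theta z) * b z + (c \<bullet> sph_theta z) * (v z \<bullet> sph_phi z))"
  have cG: "continuous_on A G1" "continuous_on A G2" for A
    unfolding G1_def G2_def by (intro continuous_intros cb cv continuous_on_sph)+
  have "((\<lambda>s. (c \<bullet> sph_phi (\<phi>, s)) * b (\<phi>, s)) has_real_derivative G1 (\<phi>, \<theta>)) (at \<theta> within A)" for \<phi> \<theta> A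
    unfolding G1_def by (rule derivative_eq_intros dc db sph_derivs refl)+ simp
  \<comment> \<open>No boundary term: \<open>sph_phi\<close> carries the factor cos \<theta>, which
    vanishes at both poles.\<close>
  then have i1: "integral {-(pi/2)..pi/2} (\<lambda>\<theta>. G1 (\<phi>, \<theta>)) = 0" for \<phi>
    using fundamental_theorem_of_calculus[of "-(pi/2)" "pi/2" "\<lambda>s. (c \<bullet> sph_phi (\<phi>, s)) * b (\<phi>, s)" "\<lambda>s. G1 (\<phi>, s)"]
    by (auto simp: has_real_derivative_iff_has_vector_derivative sph_phi_def inner_vec_def sum_3 intro!: integral_unique)
  have "((\<lambda>s. (c \<bullet> sph_theta (s, \<theta>)) * b (s, \<theta>)) has_real_derivative G2 (\<phi>, \<theta>)) (at \<phi> within A)" for \<phi> \<theta> A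
    unfolding G2_def by (rule derivative_eq_intros dc db sph_derivs refl)+ simp
  \<comment> \<open>No boundary term: everything is periodic in \<phi>.\<close>
  then have i2: "integral {0..2*pi} (\<lambda>\<phi>. G2 (\<phi>, \<theta>)) = 0" for \<theta>
    using fundamental_theorem_of_calculus[of 0 "2*pi" "\<lambda>s. (c \<bullet> sph_theta (s, \<theta>)) * b (s, \<theta>)" "\<lambda>s. G2 (s, \<theta>)"]
    by (auto simp: has_real_derivative_iff_has_vector_derivative sph_theta_def b_def spherical_def intro!: integral_unique)
  have "integral rect G1 = 0"
    by (subst integral_prod_continuous[OF cG(1)]) (simp add: i1)
  moreover have "integral rect G2 = 0"
    by (subst integral_prod_continuous[OF cG(2)], subst integral_swap_continuous) (simp_all add: i2 cG)
  moreover have "integral rect (\<lambda>z. G1 z - G2 z) = integral rect G1 - integral rect G2"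
    by (intro integral_diff integrable_continuous cG)
  moreover have "(\<integral>x. x \<bullet> cross3 c (grad3 B x) \<partial>sphere_area) = integral rect (\<lambda>z. G1 z - G2 z)"
  proof -
    have "continuous_on S2 (\<lambda>x. x \<bullet> cross3 c (grad3 B x))"
      by (intro continuous_intros continuous_on_cross cg)
    moreover have "cos (snd z) * (spherical z \<bullet> cross3 c (v z)) = G1 z - G2 z" for z
      using spherical_triple[of "snd z" "fst z" c "v z"] by (simp add: G1_def G2_def)
    ultimately show ?thesis
      by (subst integral_continuous_S2) (simp_all add: v_def)
  qed
  ultimately show ?thesis by simp
qed

section \<open>Brackets and the Laplacian\<close>

lemma integrable_bracket_linear:
  assumes B: "Ck_on 1 (-{0}) B"
  shows "integrable sphere_area (\<lambda>x. x \<bullet> cross3 c (grad3 B x))"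
proof -
  have "continuous_on S2 (grad3 B)"
    using B by (intro continuous_on_S2_punctured continuous_on_grad3[where k = 0]) auto
  then show ?thesis
    by (intro integrable_continuous_S2 continuous_intros continuous_on_cross)
qed

text \<open>The bracket {w, v} is the sum of {x_i, v d_i w} over the coordinates: differentiating v
  gives the cross product of the gradients, and differentiating d_i w gives v times the curl of a
  gradient, which is zero.\<close>

lemma integral_bracket:
  assumes w: "Ck_on 2 (-{0}) w" and v: "Ck_on 1 (-{0}) v"
  shows "(\<integral>x. x \<bullet> cross3 (grad3 w x) (grad3 v x) \<partial>sphere_area) = 0"
proof -
  define B where "B i = (\<lambda>x. v x * pderiv3 i w x)" for i
  have p: "Ck_on 1 (-{0}) (pderiv3 i w)" for i
    using w by (intro Ck_on_pderiv3) (simp add: numeral_2_eq_2)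
  have B: "Ck_on 1 (-{0}) (B i)" for i
    unfolding B_def by (intro Ck_on_mult v p) auto
  have eq: "x \<bullet> cross3 (grad3 w x) (grad3 v x) = (\<Sum>i\<in>UNIV. x \<bullet> cross3 (axis i 1) (grad3 (B i) x))"
    if "x \<in> S2" for x
  proof -
    have x: "x \<in> -{0}" using that by auto
    have d: "v differentiable (at x)" "pderiv3 i w differentiable (at x)" for i
      using Ck_on_differentiable_at[OF _ _ x, where k = 0] v p by auto
    have g: "grad3 (B i) x = v x *\<^sub>R grad3 (pderiv3 i w) x + pderiv3 i w x *\<^sub>R grad3 v x" for i
      unfolding B_def using grad3_mult[OF d(1) d(2)[of i]] by simp
    have s: "pderiv3 i (pderiv3 j w) x = pderiv3 j (pderiv3 i w) x" for i j
      by (rule pderiv3_commute[OF _ w x]) auto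
    show ?thesis
      unfolding g sum_3 cross3_def inner_vec_def vector_3 inner_real_def
      by (simp add: axis_def s[of 2 1] s[of 3 1] s[of 3 2] algebra_simps)
  qed
  have "(\<integral>x. x \<bullet> cross3 (grad3 w x) (grad3 v x) \<partial>sphere_area)
      = (\<integral>x. (\<Sum>i\<in>UNIV. x \<bullet> cross3 (axis i 1) (grad3 (B i) x)) \<partial>sphere_area)"
    by (rule Bochner_Integration.integral_cong) (use eq in auto)
  also have "\<dots> = 0"
    by (subst Bochner_Integration.integral_sum)
      (simp_all add: integrable_bracket_linear[OF B] integral_bracket_linear[OF B])
  finally show ?thesis .
qed

lemma radial_derivative_homogeneous:
  assumes "(\<lambda>y. u (sgn y)) differentiable (at y)" "y \<noteq> 0"
  shows "grad3 (\<lambda>y. u (sgn y)) y \<bullet> y = 0"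
proof -
  have "((\<lambda>s::real. u (sgn (s *\<^sub>R y))) has_derivative (\<lambda>s. grad3 (\<lambda>y. u (sgn y)) y \<bullet> (s *\<^sub>R y))) (at 1)"
    by (rule has_derivative_compose[of "\<lambda>s. s *\<^sub>R y" "\<lambda>s. s *\<^sub>R y" 1 UNIV "\<lambda>y. u (sgn y)"])
      (use has_derivative_grad3[OF assms(1)] in \<open>auto intro!: derivative_eq_intros\<close>)
  moreover have "((\<lambda>s::real. u (sgn (s *\<^sub>R y))) has_derivative (\<lambda>s. 0)) (at 1)"
    by (rule has_derivative_transform_within_open[of "\<lambda>_. u (sgn y)" _ _ _ "{0<..}"])
      (auto simp: sgn_scaleR)
  ultimately have "(\<lambda>s. grad3 (\<lambda>y. u (sgn y)) y \<bullet> (s *\<^sub>R y)) = (\<lambda>s. 0)"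
    by (rule has_derivative_unique)
  from fun_cong[OF this, of 1] show ?thesis by simp
qed

text \<open>With \<open>p = \<nabla>U\<close>, \<open>Q = D\<^sup>2U\<close>, \<open>q = p \<bullet> (e\<^sub>3 \<times> x)\<close>, \<open>r = p \<times> x\<close> and the bracket
  \<open>{A,B} = x \<bullet> (\<nabla>A \<times> \<nabla>B)\<close>, homogeneity (\<open>p \<bullet> x = 0\<close>, \<open>Q x = - p\<close>) gives
  \<open>q tr Q = (\<Sum>i. {x\<^sub>i, q r\<^sub>i}) + {x\<^sub>3, |p|\<^sup>2} / 2\<close> on the sphere.\<close>

lemma integral_laplacian_rotation:
  assumes "smooth_on S2 w"
  shows "(\<integral>x. trace (hess_S w x) * (x \<bullet> cross3 (grad_S w x) (axis 3 1)) \<partial>sphere_area) = 0"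
proof -
  define U where "U = (\<lambda>y::real^3. w (sgn y))"
  have CU: "Ck_on k (-{0}) U" for k
    unfolding U_def using assms by (rule smooth_on_imp_Ck_on_sgn)
  define p where "p i = pderiv3 i U" for i
  have Cp: "Ck_on k (-{0}) (p i)" for i k
    unfolding p_def by (intro Ck_on_pderiv3 CU)
  define q where "q = (\<lambda>y::real^3. p 2 y * y $ 1 - p 1 y * y $ 2)"
  define r1 where "r1 = (\<lambda>y::real^3. p 2 y * y $ 3 - p 3 y * y $ 2)"
  define r2 where "r2 = (\<lambda>y::real^3. p 3 y * y $ 1 - p 1 y * y $ 3)"
  define r3 where "r3 = (\<lambda>y::real^3. p 1 y * y $ 2 - p 2 y * y $ 1)"
  define N where "N = (\<lambda>y::real^3. p 1 y * p 1 y + p 2 y * p 2 y + p 3 y * p 3 y)"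
  have C: "Ck_on k (-{0}) q" "Ck_on k (-{0}) r1" "Ck_on k (-{0}) r2" "Ck_on k (-{0}) r3" "Ck_on k (-{0}) N" for k
    unfolding q_def r1_def r2_def r3_def N_def by (intro Ck_on_intros Cp open_delete open_Compl; simp)+
  have D: "f differentiable (at y)" if "\<And>k. Ck_on k (-{0}) f" "y \<noteq> 0" for f :: "real^3 \<Rightarrow> real" and y
    by (rule Ck_on_differentiable_at[OF _ that(1)]) (use that in auto)
  have Dc: "(\<lambda>y::real^3. y $ i) differentiable (at y)" for i y
    by (intro bounded_linear_imp_differentiable bounded_linear_vec_nth)
  let ?br = "\<lambda>c B x. x \<bullet> cross3 c (grad3 B x)"
  have eq: "trace (hess_S w x) * (x \<bullet> cross3 (grad_S w x) (axis 3 1))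
      = ?br (axis 1 1) (\<lambda>y. q y * r1 y) x + ?br (axis 2 1) (\<lambda>y. q y * r2 y) x
        + ?br (axis 3 1) (\<lambda>y. q y * r3 y) x + ?br (axis 3 1) N x / 2"
    if "x \<in> S2" for x
  proof -
    have x: "x \<noteq> 0" using that by auto
    have xx: "x $ 1 * x $ 1 + x $ 2 * x $ 2 + x $ 3 * x $ 3 = 1"
    proof -
      have "x \<bullet> x = 1" using that by (simp add: dot_square_norm)
      then show ?thesis by (simp add: inner_vec_def sum_3)
    qed
    define Q where "Q i j = pderiv3 j (p i) x" for i j
    have gp: "grad3 (p i) x = vector [Q i 1, Q i 2, Q i 3]" for i
      by (simp add: vec_eq_iff forall_3 Q_def)
    have Qs: "Q 2 1 = Q 1 2" "Q 3 1 = Q 1 3" "Q 3 2 = Q 2 3"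
      unfolding Q_def p_def by (rule pderiv3_commute[OF _ CU]; use x in auto)+
    note d = D[OF Cp x] D[OF C(1) x] D[OF C(2) x] D[OF C(3) x] D[OF C(4) x] D[OF C(5) x] Dc
    have rad: "p 1 y * y $ 1 + p 2 y * y $ 2 + p 3 y * y $ 3 = 0" if "y \<noteq> 0" for y
      using radial_derivative_homogeneous[of w y] D[OF CU that] that
      by (simp add: U_def[symmetric] inner_vec_def sum_3 p_def)
    \<comment> \<open>Differentiating the Euler relation p \<bullet> y = 0 gives Q x = - p.\<close>
    have "((\<lambda>y. p 1 y * y $ 1 + p 2 y * y $ 2 + p 3 y * y $ 3) has_derivative (\<lambda>h. 0 \<bullet> h)) (at x)"
      by (rule has_derivative_transform_within_open[of "\<lambda>_. 0" _ _ _ "-{0}"]) (use x rad in auto)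
    then have "grad3 (\<lambda>y. p 1 y * y $ 1 + p 2 y * y $ 2 + p 3 y * y $ 3) x = 0"
      by (rule grad3_unique)
    then have "(p 1 x *\<^sub>R axis 1 1 + x $ 1 *\<^sub>R grad3 (p 1) x) + (p 2 x *\<^sub>R axis 2 1 + x $ 2 *\<^sub>R grad3 (p 2) x)
        + (p 3 x *\<^sub>R axis 3 1 + x $ 3 *\<^sub>R grad3 (p 3) x) = 0"
      by (simp add: grad3_add grad3_mult grad3_coord d)
    then have Qx: "Q 1 1 * x $ 1 + Q 1 2 * x $ 2 + Q 1 3 * x $ 3 = - p 1 x"
      "Q 1 2 * x $ 1 + Q 2 2 * x $ 2 + Q 2 3 * x $ 3 = - p 2 x"
      "Q 1 3 * x $ 1 + Q 2 3 * x $ 2 + Q 3 3 * x $ 3 = - p 3 x"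
      by (simp_all add: vec_eq_iff forall_3 gp Qs axis_def algebra_simps)
    note px = rad[OF x]
    have gq: "grad3 q x = (p 2 x *\<^sub>R axis 1 1 + x $ 1 *\<^sub>R grad3 (p 2) x) - (p 1 x *\<^sub>R axis 2 1 + x $ 2 *\<^sub>R grad3 (p 1) x)"
      unfolding q_def by (simp add: grad3_diff grad3_mult grad3_coord d)
    have gr: "grad3 r1 x = (p 2 x *\<^sub>R axis 3 1 + x $ 3 *\<^sub>R grad3 (p 2) x) - (p 3 x *\<^sub>R axis 2 1 + x $ 2 *\<^sub>R grad3 (p 3) x)"
      "grad3 r2 x = (p 3 x *\<^sub>R axis 1 1 + x $ 1 *\<^sub>R grad3 (p 3) x) - (p 1 x *\<^sub>R axis 3 1 + x $ 3 *\<^sub>R grad3 (p 1) x)"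
      "grad3 r3 x = (p 1 x *\<^sub>R axis 2 1 + x $ 2 *\<^sub>R grad3 (p 1) x) - (p 2 x *\<^sub>R axis 1 1 + x $ 1 *\<^sub>R grad3 (p 2) x)"
      unfolding r1_def r2_def r3_def by (simp_all add: grad3_diff grad3_mult grad3_coord d)
    have gN: "grad3 N x = 2 *\<^sub>R (p 1 x *\<^sub>R grad3 (p 1) x + p 2 x *\<^sub>R grad3 (p 2) x + p 3 x *\<^sub>R grad3 (p 3) x)"
      unfolding N_def by (simp add: grad3_add grad3_mult d) (simp add: vec_eq_iff)
    have expand: "?br c (\<lambda>y. q y * r y) x = q x * ?br c r x + r x * (x \<bullet> cross3 c (grad3 q x))"
      if "r differentiable (at x)" for c r
      using that d by (simp add: grad3_mult cross_add_right inner_add_right cross_mult_right)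
    \<comment> \<open>The brackets {x_i, r_i} add up to |x|^2 tr Q - x \<bullet> Q x - 2 p \<bullet>
      x; since Q x = - p and p \<bullet> x = 0, only the trace survives.\<close>
    have S1: "?br (axis 1 1) r1 x + ?br (axis 2 1) r2 x + ?br (axis 3 1) r3 x = Q 1 1 + Q 2 2 + Q 3 3"
    proof -
      have "?br (axis 1 1) r1 x + ?br (axis 2 1) r2 x + ?br (axis 3 1) r3 x
        = (Q 1 1 + Q 2 2 + Q 3 3) * (x $ 1 * x $ 1 + x $ 2 * x $ 2 + x $ 3 * x $ 3)
          - (x $ 1 * (Q 1 1 * x $ 1 + Q 1 2 * x $ 2 + Q 1 3 * x $ 3)
            + x $ 2 * (Q 1 2 * x $ 1 + Q 2 2 * x $ 2 + Q 2 3 * x $ 3)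
            + x $ 3 * (Q 1 3 * x $ 1 + Q 2 3 * x $ 2 + Q 3 3 * x $ 3))
          - 2 * (p 1 x * x $ 1 + p 2 x * x $ 2 + p 3 x * x $ 3)"
        unfolding gr gp Qs cross3_def inner_vec_def sum_3 inner_real_def
        by (simp add: axis_def algebra_simps)
      also have "\<dots> = Q 1 1 + Q 2 2 + Q 3 3"
        unfolding xx Qx using px by (simp add: algebra_simps)
      finally show ?thesis .
    qed
    have tr: "x $ 2 * r3 x - x $ 3 * r2 x = p 1 x" "x $ 3 * r1 x - x $ 1 * r3 x = p 2 x"
      "x $ 1 * r2 x - x $ 2 * r1 x = p 3 x"
      unfolding r1_def r2_def r3_def using xx px by algebra+
    \<comment> \<open>Since x \<times> r = p, the first three terms are the derivative of q along p.
      The terms quadratic in p cancel there, leaving Q p \<bullet> (e_3 \<times> x), which is half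
      the rotation derivative of |p|^2.\<close>
    have S2: "r1 x * ?br (axis 1 1) q x + r2 x * ?br (axis 2 1) q x + r3 x * ?br (axis 3 1) q x
        + ?br (axis 3 1) N x / 2 = 0"
    proof -
      have "r1 x * ?br (axis 1 1) q x + r2 x * ?br (axis 2 1) q x + r3 x * ?br (axis 3 1) q x
        = (x $ 2 * r3 x - x $ 3 * r2 x) * grad3 q x $ 1 + (x $ 3 * r1 x - x $ 1 * r3 x) * grad3 q x $ 2
          + (x $ 1 * r2 x - x $ 2 * r1 x) * grad3 q x $ 3"
        unfolding cross3_def inner_vec_def sum_3 inner_real_def
        by (simp add: axis_def algebra_simps del: grad3_nth)
      also have "\<dots> = p 1 x * grad3 q x $ 1 + p 2 x * grad3 q x $ 2 + p 3 x * grad3 q x $ 3"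
        unfolding tr ..
      also have "\<dots> = - ?br (axis 3 1) N x / 2"
        unfolding gq gN gp Qs cross3_def inner_vec_def sum_3 inner_real_def
        by (simp add: axis_def algebra_simps)
      finally show ?thesis by simp
    qed
    have "trace (hess_S w x) = Q 1 1 + Q 2 2 + Q 3 3"
      by (simp add: trace_def sum_3 hess_S_def Q_def p_def U_def)
    moreover have "x \<bullet> cross3 (grad_S w x) (axis 3 1) = q x"
      by (simp add: grad_S_eq U_def[symmetric] q_def p_def cross3_def inner_vec_def sum_3 axis_def)
    moreover have "(Q 1 1 + Q 2 2 + Q 3 3) * q x = ?br (axis 1 1) (\<lambda>y. q y * r1 y) x + ?br (axis 2 1) (\<lambda>y. q y * r2 y) x
        + ?br (axis 3 1) (\<lambda>y. q y * r3 y) x + ?br (axis 3 1) N x / 2"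
      unfolding expand[OF d(3)] expand[OF d(4)] expand[OF d(5)] S1[symmetric]
      using S2 by (simp add: algebra_simps)
    ultimately show ?thesis by metis
  qed
  have CB: "Ck_on 1 (-{0}) (\<lambda>y. q y * r1 y)" "Ck_on 1 (-{0}) (\<lambda>y. q y * r2 y)"
    "Ck_on 1 (-{0}) (\<lambda>y. q y * r3 y)" "Ck_on 1 (-{0}) N"
    by (auto intro!: Ck_on_mult C simp del: One_nat_def)
  note I = integrable_bracket_linear[OF CB(1), of "axis 1 1"] integrable_bracket_linear[OF CB(2), of "axis 2 1"]
    integrable_bracket_linear[OF CB(3), of "axis 3 1"] integrable_bracket_linear[OF CB(4), of "axis 3 1"]
  have "(\<integral>x. trace (hess_S w x) * (x \<bullet> cross3 (grad_S w x) (axis 3 1)) \<partial>sphere_area)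
      = (\<integral>x. ?br (axis 1 1) (\<lambda>y. q y * r1 y) x + ?br (axis 2 1) (\<lambda>y. q y * r2 y) x
        + ?br (axis 3 1) (\<lambda>y. q y * r3 y) x + ?br (axis 3 1) N x / 2 \<partial>sphere_area)"
    by (rule Bochner_Integration.integral_cong) (use eq in auto)
  also have "\<dots> = 0"
    using I by (simp add: integral_bracket_linear CB del: One_nat_def)
  finally show ?thesis .
qed

section \<open>Convergence in \<open>L\<^sup>2\<close> and the Green operator\<close>

lemma Lp_norm_powr:
  assumes "p > 0"
  shows "Lp_norm p f powr p = (\<integral>x. norm (f x) powr p \<partial>sphere_area)"
proof -
  have "0 \<le> (\<integral>x. norm (f x) powr p \<partial>sphere_area)" by (intro Bochner_Integration.integral_nonneg) simp
  then show ?thesis using assms by (simp add: Lp_norm_def powr_powr)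
qed

lemma Lp_norm_tendsto_0:
  assumes "p > 0" "(\<lambda>n. Lp_norm p (f n)) \<longlonglongrightarrow> 0"
  shows "(\<lambda>n. \<integral>x. norm (f n x) powr p \<partial>sphere_area) \<longlonglongrightarrow> 0"
proof -
  have "(\<lambda>n. Lp_norm p (f n) powr p) \<longlonglongrightarrow> 0 powr p"
    by (rule tendsto_powr') (use assms in \<open>auto simp: Lp_norm_def\<close>)
  then show ?thesis by (simp add: Lp_norm_powr assms(1))
qed

lemma integrable_mult_L2:
  fixes f g :: "'a \<Rightarrow> real"
  assumes [measurable]: "f \<in> borel_measurable M" "g \<in> borel_measurable M"
    and "integrable M (\<lambda>x. (f x)\<^sup>2)" "integrable M (\<lambda>x. (g x)\<^sup>2)"
  shows "integrable M (\<lambda>x. f x * g x)"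
proof (rule Bochner_Integration.integrable_bound)
  show "integrable M (\<lambda>x. (f x)\<^sup>2 + (g x)\<^sup>2)" using assms by auto
  have "\<bar>a * b\<bar> \<le> a\<^sup>2 + b\<^sup>2" for a b :: real
  proof -
    have "2 * (\<bar>a\<bar> * \<bar>b\<bar>) \<le> a\<^sup>2 + b\<^sup>2"
      using sum_squares_bound[of "\<bar>a\<bar>" "\<bar>b\<bar>"] by (simp add: mult.assoc)
    moreover have "0 \<le> \<bar>a\<bar> * \<bar>b\<bar>" by simp
    ultimately show ?thesis unfolding abs_mult by linarith
  qed
  then show "AE x in M. norm (f x * g x) \<le> norm ((f x)\<^sup>2 + (g x)\<^sup>2)" by simp
qed simp

lemma Cauchy_Schwarz_integral:
  fixes f g :: "'a \<Rightarrow> real"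
  assumes [measurable]: "f \<in> borel_measurable M" "g \<in> borel_measurable M"
    and f: "integrable M (\<lambda>x. (f x)\<^sup>2)" and g: "integrable M (\<lambda>x. (g x)\<^sup>2)"
  shows "\<bar>\<integral>x. f x * g x \<partial>M\<bar> \<le> sqrt (\<integral>x. (f x)\<^sup>2 \<partial>M) * sqrt (\<integral>x. (g x)\<^sup>2 \<partial>M)"
proof -
  let ?A = "\<integral>x. (f x)\<^sup>2 \<partial>M" and ?B = "\<integral>x. (g x)\<^sup>2 \<partial>M" and ?C = "\<integral>x. \<bar>f x * g x\<bar> \<partial>M"
  have i: "integrable M (\<lambda>x. f x * g x)"
    by (rule integrable_mult_L2) (use f g in auto)
  have "ennreal (?C\<^sup>2) = (\<integral>\<^sup>+x. ennreal \<bar>f x\<bar> * ennreal \<bar>g x\<bar> \<partial>M)\<^sup>2"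
  proof -
    have "ennreal ?C = (\<integral>\<^sup>+x. ennreal \<bar>f x * g x\<bar> \<partial>M)"
      by (rule nn_integral_eq_integral[symmetric]) (use i in auto)
    then show ?thesis
      by (simp add: ennreal_power[symmetric] abs_mult ennreal_mult)
  qed
  also have "\<dots> \<le> (\<integral>\<^sup>+x. ennreal \<bar>f x\<bar> ^ 2 \<partial>M) * (\<integral>\<^sup>+x. ennreal \<bar>g x\<bar> ^ 2 \<partial>M)"
    by (rule Cauchy_Schwarz_nn_integral) auto
  also have "\<dots> = ennreal (?A * ?B)"
    using f g by (simp add: ennreal_power nn_integral_eq_integral ennreal_mult)
  finally have "?C\<^sup>2 \<le> ?A * ?B" by simp
  then have "?C \<le> sqrt (?A * ?B)"
    by (rule real_le_rsqrt)
  then have "?C \<le> sqrt ?A * sqrt ?B" by (simp only: real_sqrt_mult)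
  with integral_abs_bound show ?thesis by (rule order_trans)
qed

definition L2_tendsto :: "'a measure \<Rightarrow> (nat \<Rightarrow> 'a \<Rightarrow> real) \<Rightarrow> ('a \<Rightarrow> real) \<Rightarrow> bool" where
  "L2_tendsto M u v \<longleftrightarrow> (\<forall>n. u n \<in> borel_measurable M \<and> integrable M (\<lambda>x. (u n x)\<^sup>2)) \<and>
     v \<in> borel_measurable M \<and> integrable M (\<lambda>x. (v x)\<^sup>2) \<and>
     (\<lambda>n. \<integral>x. (u n x - v x)\<^sup>2 \<partial>M) \<longlonglongrightarrow> 0"

text \<open>The difference u v - u' v' splits into (u - u')(v - v') + (u - u') v' + u' (v - v'), and
  Cauchy-Schwarz bounds each integral by quantities that tend to zero.\<close>

lemma integral_mult_L2_tendsto: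
  assumes u: "L2_tendsto M u u'" and v: "L2_tendsto M v v'"
  shows "(\<lambda>n. \<integral>x. u n x * v n x \<partial>M) \<longlonglongrightarrow> (\<integral>x. u' x * v' x \<partial>M)"
proof -
  note [measurable] = u[unfolded L2_tendsto_def, THEN conjunct1, THEN spec, THEN conjunct1]
    v[unfolded L2_tendsto_def, THEN conjunct1, THEN spec, THEN conjunct1]
  have [measurable]: "u' \<in> borel_measurable M" "v' \<in> borel_measurable M"
    and i: "\<And>n. integrable M (\<lambda>x. (u n x)\<^sup>2)" "\<And>n. integrable M (\<lambda>x. (v n x)\<^sup>2)"
      "integrable M (\<lambda>x. (u' x)\<^sup>2)" "integrable M (\<lambda>x. (v' x)\<^sup>2)"
    and l: "(\<lambda>n. \<integral>x. (u n x - u' x)\<^sup>2 \<partial>M) \<longlonglongrightarrow> 0" "(\<lambda>n. \<integral>x. (v n x - v' x)\<^sup>2 \<partial>M) \<longlonglongrightarrow> 0"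
    using u v by (auto simp: L2_tendsto_def)
  have di: "integrable M (\<lambda>x. (f x - g x)\<^sup>2)"
    if [measurable]: "f \<in> borel_measurable M" "g \<in> borel_measurable M" and "integrable M (\<lambda>x. (f x)\<^sup>2)" "integrable M (\<lambda>x. (g x)\<^sup>2)"
    for f g :: "_ \<Rightarrow> real"
    using that integrable_mult_L2[OF that] by (simp add: power2_diff mult.assoc)
  let ?a = "\<lambda>n. sqrt (\<integral>x. (u n x - u' x)\<^sup>2 \<partial>M)" and ?b = "\<lambda>n. sqrt (\<integral>x. (v n x - v' x)\<^sup>2 \<partial>M)"
  have du: "integrable M (\<lambda>x. (u n x - u' x)\<^sup>2)" and dv: "integrable M (\<lambda>x. (v n x - v' x)\<^sup>2)" for n
    by (intro di i; measurable)+
  have bound: "\<bar>(\<integral>x. u n x * v n x \<partial>M) - (\<integral>x. u' x * v' x \<partial>M)\<bar>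
      \<le> ?a n * ?b n + ?a n * sqrt (\<integral>x. (v' x)\<^sup>2 \<partial>M) + sqrt (\<integral>x. (u' x)\<^sup>2 \<partial>M) * ?b n" for n
  proof -
    have I: "integrable M (\<lambda>x. (u n x - u' x) * (v n x - v' x))" "integrable M (\<lambda>x. (u n x - u' x) * v' x)"
      "integrable M (\<lambda>x. u' x * (v n x - v' x))" "integrable M (\<lambda>x. u n x * v n x)" "integrable M (\<lambda>x. u' x * v' x)"
      by (intro integrable_mult_L2 du dv i; measurable)+
    have "(\<integral>x. u n x * v n x \<partial>M) - (\<integral>x. u' x * v' x \<partial>M) = (\<integral>x. u n x * v n x - u' x * v' x \<partial>M)"
      using I by simp
    also have "\<dots> = (\<integral>x. (u n x - u' x) * (v n x - v' x) + (u n x - u' x) * v' x + u' x * (v n x - v' x) \<partial>M)"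
      by (intro Bochner_Integration.integral_cong) (auto simp: algebra_simps)
    also have "\<dots> = (\<integral>x. (u n x - u' x) * (v n x - v' x) \<partial>M) + (\<integral>x. (u n x - u' x) * v' x \<partial>M)
        + (\<integral>x. u' x * (v n x - v' x) \<partial>M)"
      using I by simp
    finally have *: "(\<integral>x. u n x * v n x \<partial>M) - (\<integral>x. u' x * v' x \<partial>M) = \<dots>" .
    have "\<bar>\<integral>x. (u n x - u' x) * (v n x - v' x) \<partial>M\<bar> \<le> ?a n * ?b n"
      "\<bar>\<integral>x. (u n x - u' x) * v' x \<partial>M\<bar> \<le> ?a n * sqrt (\<integral>x. (v' x)\<^sup>2 \<partial>M)"
      "\<bar>\<integral>x. u' x * (v n x - v' x) \<partial>M\<bar> \<le> sqrt (\<integral>x. (u' x)\<^sup>2 \<partial>M) * ?b n"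
      by (intro Cauchy_Schwarz_integral du dv i; measurable)+
    then show ?thesis unfolding * by linarith
  qed
  have "?a \<longlonglongrightarrow> 0" "?b \<longlonglongrightarrow> 0"
    using tendsto_real_sqrt[OF l(1)] tendsto_real_sqrt[OF l(2)] by simp_all
  then have "(\<lambda>n. ?a n * ?b n + ?a n * sqrt (\<integral>x. (v' x)\<^sup>2 \<partial>M) + sqrt (\<integral>x. (u' x)\<^sup>2 \<partial>M) * ?b n) \<longlonglongrightarrow>
      0 * 0 + 0 * sqrt (\<integral>x. (v' x)\<^sup>2 \<partial>M) + sqrt (\<integral>x. (u' x)\<^sup>2 \<partial>M) * 0"
    by (intro tendsto_intros)
  then have "(\<lambda>n. ?a n * ?b n + ?a n * sqrt (\<integral>x. (v' x)\<^sup>2 \<partial>M) + sqrt (\<integral>x. (u' x)\<^sup>2 \<partial>M) * ?b n) \<longlonglongrightarrow> 0"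
    by simp
  then have "(\<lambda>n. (\<integral>x. u n x * v n x \<partial>M) - (\<integral>x. u' x * v' x \<partial>M)) \<longlonglongrightarrow> 0"
    by (rule Lim_null_comparison[rotated]) (use bound in auto)
  then show ?thesis by (simp add: LIM_zero_iff)
qed

text \<open>A continuous field on the compact sphere is bounded, so contraction with it preserves
  L^2 convergence. The general value type covers gradients and Hessians alike, the trace being the
  inner product with \<open>mat 1\<close>.\<close>

lemma L2_tendsto_inner:
  fixes X :: "nat \<Rightarrow> real^3 \<Rightarrow> 'b::euclidean_space"
  assumes X: "\<And>n. continuous_on S2 (X n)" "in_Lp 2 Y"
    and lim: "(\<lambda>n. Lp_norm 2 (\<lambda>x. X n x - Y x)) \<longlonglongrightarrow> 0"
    and d: "continuous_on S2 d"
  shows "L2_tendsto sphere_area (\<lambda>n x. X n x \<bullet> d x) (\<lambda>x. Y x \<bullet> d x)"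
proof -
  obtain K where "\<forall>x\<in>S2. norm (d x) \<le> K"
    using compact_imp_bounded[OF compact_continuous_image[OF d compact_sphere]]
    unfolding bounded_iff by auto
  then have K: "norm (d x) \<le> K" if "x \<in> S2" for x
    using that by blast
  have [measurable]: "d \<in> borel_measurable sphere_area"
    by (rule borel_measurable_continuous_S2[OF d])
  have m: "(\<lambda>x. Z x \<bullet> d x) \<in> borel_measurable sphere_area" if "Z \<in> borel_measurable sphere_area" for Z
    using that by measurable
  have Ym: "Y \<in> borel_measurable sphere_area" and Yi: "integrable sphere_area (\<lambda>x. (norm (Y x))\<^sup>2)"
    using X(2) by (simp_all add: in_Lp_def)
  have Xm: "X n \<in> borel_measurable sphere_area" for n
    by (rule borel_measurable_continuous_S2[OF X(1)])
  have Xi: "integrable sphere_area (\<lambda>x. (norm (X n x))\<^sup>2)" for n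
    by (intro integrable_continuous_S2 continuous_intros X)
  have sq: "(a \<bullet> d x)\<^sup>2 \<le> K\<^sup>2 * (norm a)\<^sup>2" if "x \<in> S2" for x a
  proof -
    have "\<bar>a \<bullet> d x\<bar> \<le> norm a * K"
      using order_trans[OF Cauchy_Schwarz_ineq2 mult_left_mono[OF K[OF that] norm_ge_zero]] .
    from power_mono[OF this, of 2] show ?thesis by (simp add: power_mult_distrib mult.commute)
  qed
  have int: "integrable sphere_area (\<lambda>x. (Z x \<bullet> d x)\<^sup>2)"
    if "Z \<in> borel_measurable sphere_area" "integrable sphere_area (\<lambda>x. (norm (Z x))\<^sup>2)" for Z
    by (rule Bochner_Integration.integrable_bound[of _ "\<lambda>x. K\<^sup>2 * (norm (Z x))\<^sup>2"])
      (use that m[OF that(1)] sq in \<open>auto intro!: AE_I2\<close>)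
  have Di: "integrable sphere_area (\<lambda>x. (norm (X n x - Y x))\<^sup>2)" for n
  proof (rule Bochner_Integration.integrable_bound)
    show "integrable sphere_area (\<lambda>x. 2 * (norm (X n x))\<^sup>2 + 2 * (norm (Y x))\<^sup>2)"
      using Xi Yi by simp
    have "(norm (a - b))\<^sup>2 \<le> 2 * (norm a)\<^sup>2 + 2 * (norm b)\<^sup>2" for a b :: 'b
    proof -
      have "(norm (a - b))\<^sup>2 + (norm (a + b))\<^sup>2 = 2 * (norm a)\<^sup>2 + 2 * (norm b)\<^sup>2"
        by (simp add: power2_norm_eq_inner inner_simps inner_commute)
      then show ?thesis using zero_le_power2[of "norm (a + b)"] by linarith
    qed
    then show "AE x in sphere_area. norm ((norm (X n x - Y x))\<^sup>2) \<le> norm (2 * (norm (X n x))\<^sup>2 + 2 * (norm (Y x))\<^sup>2)"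
      by simp
  qed (use Xm Ym in measurable)
  have lim': "(\<lambda>n. K\<^sup>2 * (\<integral>x. (norm (X n x - Y x))\<^sup>2 \<partial>sphere_area)) \<longlonglongrightarrow> 0"
    using tendsto_mult_right_zero[OF Lp_norm_tendsto_0[OF _ lim], of "K\<^sup>2"] by simp
  have "(\<lambda>n. \<integral>x. (X n x \<bullet> d x - Y x \<bullet> d x)\<^sup>2 \<partial>sphere_area) \<longlonglongrightarrow> 0"
  proof (rule tendsto_sandwich[OF _ _ tendsto_const lim'])
    show "\<forall>\<^sub>F n in sequentially. 0 \<le> (\<integral>x. (X n x \<bullet> d x - Y x \<bullet> d x)\<^sup>2 \<partial>sphere_area)"
      by (intro always_eventually allI Bochner_Integration.integral_nonneg) simp
    have "(\<integral>x. (X n x \<bullet> d x - Y x \<bullet> d x)\<^sup>2 \<partial>sphere_area)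
        \<le> (\<integral>x. K\<^sup>2 * (norm (X n x - Y x))\<^sup>2 \<partial>sphere_area)" for n
    proof (rule integral_mono')
      show "(X n x \<bullet> d x - Y x \<bullet> d x)\<^sup>2 \<le> K\<^sup>2 * (norm (X n x - Y x))\<^sup>2" if "x \<in> space sphere_area" for x
        using sq[of x "X n x - Y x"] that by (simp add: inner_diff_left)
    qed (use Di in auto)
    then show "\<forall>\<^sub>F n in sequentially. (\<integral>x. (X n x \<bullet> d x - Y x \<bullet> d x)\<^sup>2 \<partial>sphere_area)
        \<le> K\<^sup>2 * (\<integral>x. (norm (X n x - Y x))\<^sup>2 \<partial>sphere_area)" by simp
  qed
  then show ?thesis
    unfolding L2_tendsto_def using int[OF Xm Xi] int[OF Ym Yi] m[OF Xm] m[OF Ym] by auto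
qed

lemma trace_eq_inner: "trace (A :: real^'n^'n) = A \<bullet> mat 1"
  by (simp add: trace_def inner_vec_def mat_def if_distrib cong: if_cong)

lemma triple_product_inner: "x \<bullet> cross3 a c = a \<bullet> cross3 c x"
  by (simp add: cross3_simps)

lemma continuous_on_grad_S:
  assumes "smooth_on S2 w"
  shows "continuous_on S2 (grad_S w)"
  unfolding grad_S_eq
  by (intro continuous_on_S2_punctured continuous_on_grad3[where k = 0] smooth_on_imp_Ck_on_sgn assms) auto

lemma continuous_on_hess_S:
  assumes "smooth_on S2 w"
  shows "continuous_on S2 (hess_S w)"
proof -
  have C: "Ck_on (Suc (Suc k)) (-{0}) (\<lambda>y. w (sgn y))" for k
    using assms by (rule smooth_on_imp_Ck_on_sgn)
  have "continuous_on S2 (pderiv3 j (pderiv3 i (\<lambda>y. w (sgn y))))" for i j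
    using Ck_on_pderiv3[OF Ck_on_pderiv3[OF C[of 0]]]
    by (intro continuous_on_S2_punctured) simp
  then show ?thesis
    unfolding hess_S_def by (intro continuous_on_vec_lambda)
qed

text \<open>All three hold for the approximating smooth functions and survive the limit. The
  gradients suffice for the first two; the momentum identity pairs gradient and trace of the
  Hessian, both convergent in L^2, and \<open>f\<close> replaces minus the trace only almost
  everywhere.\<close>

lemma
  assumes "green 2 f \<psi> g" "f \<in> borel_measurable sphere_area"
  shows integrable_bracket_green:
      "continuous_on S2 c \<Longrightarrow> integrable sphere_area (\<lambda>x. x \<bullet> cross3 (g x) (c x))"
    and integral_bracket_green:
      "Ck_on 1 (-{0}) v \<Longrightarrow> (\<integral>x. x \<bullet> cross3 (g x) (grad3 v x) \<partial>sphere_area) = 0"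
    and integral_momentum_green: "(\<integral>x. f x * (x \<bullet> cross3 (g x) (axis 3 1)) \<partial>sphere_area) = 0"
proof -
  obtain H w where g: "in_Lp 2 g" "in_Lp 2 H" and f: "AE x in sphere_area. - trace (H x) = f x"
    and w: "\<And>n. smooth_on S2 (w n)"
    and lim: "(\<lambda>n. Lp_norm 2 (\<lambda>x. grad_S (w n) x - g x)) \<longlonglongrightarrow> 0"
      "(\<lambda>n. Lp_norm 2 (\<lambda>x. hess_S (w n) x - H x)) \<longlonglongrightarrow> 0"
    using assms(1) unfolding green_def sobolev2_def by blast
  have G: "L2_tendsto sphere_area (\<lambda>n x. x \<bullet> cross3 (grad_S (w n) x) (c x)) (\<lambda>x. x \<bullet> cross3 (g x) (c x))"
    if "continuous_on S2 c" for c
    unfolding triple_product_inner[of x "grad_S (w n) x" "c x" for n x] triple_product_inner[of x "g x" "c x" for x]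
    by (rule L2_tendsto_inner[OF continuous_on_grad_S[OF w] g(1) lim(1) continuous_on_cross[OF that continuous_on_id]])
  have T: "L2_tendsto sphere_area (\<lambda>n x. trace (hess_S (w n) x)) (\<lambda>x. trace (H x))"
    unfolding trace_eq_inner
    by (rule L2_tendsto_inner[OF continuous_on_hess_S[OF w] g(2) lim(2) continuous_on_const])
  \<comment> \<open>The constant partner reduces the limit of a single integral to the limit of a
    product.\<close>
  have O: "L2_tendsto sphere_area (\<lambda>n x. 1) (\<lambda>x. 1)"
    unfolding L2_tendsto_def by auto
  show "integrable sphere_area (\<lambda>x. x \<bullet> cross3 (g x) (c x))" if "continuous_on S2 c"
  proof -
    have "(\<lambda>x. x \<bullet> cross3 (g x) (c x)) \<in> borel_measurable sphere_area"
      "integrable sphere_area (\<lambda>x. (x \<bullet> cross3 (g x) (c x))\<^sup>2)"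
      using G[OF that] unfolding L2_tendsto_def by blast+
    from integrable_mult_L2[OF this(1) borel_measurable_const[of 1] this(2)]
    show ?thesis by simp
  qed
  show "(\<integral>x. x \<bullet> cross3 (g x) (grad3 v x) \<partial>sphere_area) = 0" if v: "Ck_on 1 (-{0}) v"
  proof -
    have "continuous_on S2 (grad3 v)"
      using v by (intro continuous_on_S2_punctured continuous_on_grad3[where k = 0]) auto
    from integral_mult_L2_tendsto[OF G[OF this] O]
    have "(\<lambda>n. \<integral>x. x \<bullet> cross3 (grad_S (w n) x) (grad3 v x) \<partial>sphere_area)
        \<longlonglongrightarrow> (\<integral>x. x \<bullet> cross3 (g x) (grad3 v x) \<partial>sphere_area)"
      by simp
    moreover have "(\<integral>x. x \<bullet> cross3 (grad_S (w n) x) (grad3 v x) \<partial>sphere_area) = 0" for n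
      unfolding grad_S_eq by (rule integral_bracket[OF smooth_on_imp_Ck_on_sgn[OF w] v])
    ultimately show ?thesis by (simp add: LIMSEQ_const_iff)
  qed
  have gm: "(\<lambda>x. x \<bullet> cross3 (g x) (axis 3 1)) \<in> borel_measurable sphere_area"
    using G[OF continuous_on_const] unfolding L2_tendsto_def by blast
  have Hm: "(\<lambda>x. trace (H x)) \<in> borel_measurable sphere_area"
    using T unfolding L2_tendsto_def by blast
  have m: "(\<lambda>x. f x * (x \<bullet> cross3 (g x) (axis 3 1))) \<in> borel_measurable sphere_area"
    "(\<lambda>x. - (trace (H x) * (x \<bullet> cross3 (g x) (axis 3 1)))) \<in> borel_measurable sphere_area"
    by (intro borel_measurable_times borel_measurable_uminus gm Hm assms(2))+
  have "(\<lambda>n. \<integral>x. trace (hess_S (w n) x) * (x \<bullet> cross3 (grad_S (w n) x) (axis 3 1)) \<partial>sphere_area)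
      \<longlonglongrightarrow> (\<integral>x. trace (H x) * (x \<bullet> cross3 (g x) (axis 3 1)) \<partial>sphere_area)"
    by (intro integral_mult_L2_tendsto T G continuous_on_const)
  then have "(\<integral>x. trace (H x) * (x \<bullet> cross3 (g x) (axis 3 1)) \<partial>sphere_area) = 0"
    by (simp add: integral_laplacian_rotation[OF w] LIMSEQ_const_iff)
  moreover have "(\<integral>x. f x * (x \<bullet> cross3 (g x) (axis 3 1)) \<partial>sphere_area)
      = - (\<integral>x. trace (H x) * (x \<bullet> cross3 (g x) (axis 3 1)) \<partial>sphere_area)"
  proof -
    have "(\<integral>x. f x * (x \<bullet> cross3 (g x) (axis 3 1)) \<partial>sphere_area)
        = (\<integral>x. - (trace (H x) * (x \<bullet> cross3 (g x) (axis 3 1))) \<partial>sphere_area)"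
      by (rule integral_cong_AE[OF m], rule eventually_mono[OF f]) (metis mult_minus_left)
    then show ?thesis by simp
  qed
  ultimately show "(\<integral>x. f x * (x \<bullet> cross3 (g x) (axis 3 1)) \<partial>sphere_area) = 0" by simp
qed

section \<open>Conservation laws\<close>

lemma triple_cross_eq: "cross3 x v \<bullet> w = x \<bullet> cross3 v w"
  by (simp add: cross3_simps)

text \<open>The Coriolis stream function is invariant under rotation about the axis. In detail,
  \<open>grad_S\<close> differentiates \<omega> x_3 / |x|, whose gradient on the sphere is \<omega>
  e_3 minus a multiple of x; both parts drop out of a triple product containing x and e_3.\<close>

lemma coriolis_bracket_axis:
  assumes "x \<in> S2"
  shows "x \<bullet> cross3 (grad_S (\<lambda>y. \<omega> * y $ 3) x) (axis 3 1) = 0"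
proof -
  define A where "A = (\<lambda>y::real^3. \<omega> * sgn y $ 3)"
  have x: "x \<noteq> 0" "norm x = 1" using assms by auto
  have "Ck_on 1 (-{0}) A"
    unfolding A_def
    using Ck_on_sgn[of 1 "axis 3 1 :: real^3"] by (intro Ck_on_mult Ck_on_const) (auto simp: inner_axis)
  then have dA: "A differentiable (at x)"
    using x by (intro Ck_on_differentiable_at[of "-{0}" 0]) auto
  have dn: "norm differentiable (at x)" using x by simp
  have gn: "grad3 norm x = x"
    using has_derivative_norm[OF x(1)] x
    by (intro grad3_unique) (simp add: sgn_div_norm inner_commute)
  have g3: "grad3 (\<lambda>y. \<omega> * y $ 3) x = \<omega> *\<^sub>R axis 3 1"
    by (rule grad3_unique)
      (auto intro!: derivative_eq_intros bounded_linear.has_derivative[OF bounded_linear_vec_nth] simp: inner_axis')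
  have "A y * norm y = \<omega> * y $ 3" for y
    by (cases "y = 0") (simp_all add: A_def sgn_div_norm)
  then have "A x *\<^sub>R x + grad3 A x = \<omega> *\<^sub>R axis 3 1"
    using grad3_mult[OF dA dn] gn g3 x by simp
  then have gA: "grad3 A x = \<omega> *\<^sub>R axis 3 1 - A x *\<^sub>R x"
    by (simp add: algebra_simps)
  have "grad_S (\<lambda>y. \<omega> * y $ 3) x = grad3 A x"
    unfolding grad_S_eq A_def ..
  then show ?thesis
    unfolding gA by (simp add: Cross3.left_diff_distrib cross_mult_left inner_diff_right dot_cross_self)
qed

section \<open>The equation at one fixed time, with \<open>D\<close> in the role of the time
  derivative\<close>

context
  fixes \<omega> :: real and z D \<psi> :: "real^3 \<Rightarrow> real" and g :: "real^3 \<Rightarrow> real^3"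
  assumes z: "smooth_on S2 z" and D: "continuous_on S2 D" and gr: "green 2 z \<psi> g"
    and eq: "AE x in sphere_area.
      D x + rot_J x (grad_S (\<lambda>y. \<omega> * y $ 3) x - g x) \<bullet> grad_S z x = 0"
begin

private definition "Z = (\<lambda>y. z (sgn y))"
private definition "A = (\<lambda>y::real^3. \<omega> * sgn y $ 3)"

private lemma Z: "Ck_on k (-{0}) Z" "grad_S z = grad3 Z" "x \<in> S2 \<Longrightarrow> Z x = z x"
  unfolding Z_def using smooth_on_imp_Ck_on_sgn[OF z] by (auto simp: grad_S_eq sgn_div_norm)

private lemma A: "Ck_on k (-{0}) A" "grad_S (\<lambda>y. \<omega> * y $ 3) = grad3 A"
  unfolding A_def grad_S_eq
  using Ck_on_sgn[of k "axis 3 1 :: real^3"]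
  by (auto intro!: Ck_on_mult Ck_on_const simp: inner_axis)

private lemma z_cont: "continuous_on S2 z"
proof -
  have "continuous_on S2 Z"
    using Ck_on_imp_continuous_on[OF _ Z(1)] by (intro continuous_on_S2_punctured) auto
  then show ?thesis by (rule continuous_on_eq) (rule Z(3))
qed

private lemma grad3_cont: "Ck_on 1 (-{0}) v \<Longrightarrow> continuous_on S2 (grad3 v)"
  by (intro continuous_on_S2_punctured continuous_on_grad3[where k = 0]) auto

private lemma diff: "(\<And>k. Ck_on k (-{0}) v) \<Longrightarrow> x \<in> S2 \<Longrightarrow> v differentiable (at x)" for v :: "real^3 \<Rightarrow> real"
  by (rule Ck_on_differentiable_at[of "-{0}" 0]) auto

private lemmas green = gr borel_measurable_continuous_S2[OF z_cont]

text \<open>The test function \<open>v\<close> has gradient \<open>m \<nabla>z + n e\<^sub>3\<close>, so that multiplying the equation by \<open>m\<close>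
  gives brackets with \<open>v\<close> up to a multiple of \<open>\<nabla>x\<^sub>3\<close>.\<close>

private lemma integral_test:
  assumes v: "\<And>k. Ck_on k (-{0}) v"
    and gv: "\<And>x. x \<in> S2 \<Longrightarrow> grad3 v x = m x *\<^sub>R grad3 Z x + n x *\<^sub>R axis 3 1"
    and m: "continuous_on S2 m" and n: "continuous_on S2 n"
  shows "(\<integral>x. m x * D x \<partial>sphere_area) = - (\<integral>x. n x * (x \<bullet> cross3 (g x) (axis 3 1)) \<partial>sphere_area)"
proof -
  have i1: "integrable sphere_area (\<lambda>x. x \<bullet> cross3 (g x) (grad3 v x))"
    by (rule integrable_bracket_green[OF green grad3_cont[OF v]])
  have "integrable sphere_area (\<lambda>x. x \<bullet> cross3 (g x) (n x *\<^sub>R axis 3 1))"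
    by (rule integrable_bracket_green[OF green]) (intro continuous_intros n)
  then have i2: "integrable sphere_area (\<lambda>x. n x * (x \<bullet> cross3 (g x) (axis 3 1)))"
    by (simp add: cross_mult_right)
  have i3: "integrable sphere_area (\<lambda>x. x \<bullet> cross3 (grad3 A x) (grad3 v x))"
    by (intro integrable_continuous_S2 continuous_intros continuous_on_cross grad3_cont A v)
  have i4: "integrable sphere_area (\<lambda>x. m x * D x)"
    by (intro integrable_continuous_S2 continuous_intros m D)
  \<comment> \<open>The Coriolis bracket does not see the part n e_3 of the gradient of
    \<open>v\<close>, but the bracket with \<open>g\<close> does; this is the remainder on the
    right.\<close>
  have "AE x in sphere_area. m x * D x + x \<bullet> cross3 (grad3 A x) (grad3 v x)
      = x \<bullet> cross3 (g x) (grad3 v x) - n x * (x \<bullet> cross3 (g x) (axis 3 1))"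
    using eq AE_space
  proof eventually_elim
    case (elim x)
    then have x: "x \<in> S2" by simp
    have "D x = x \<bullet> cross3 (g x) (grad3 Z x) - x \<bullet> cross3 (grad3 A x) (grad3 Z x)"
      using elim(1) unfolding rot_J_def triple_cross_eq A(2) Z(2)
      by (simp add: inner_diff_right Cross3.left_diff_distrib)
    then have "m x * D x = x \<bullet> cross3 (g x) (m x *\<^sub>R grad3 Z x) - x \<bullet> cross3 (grad3 A x) (m x *\<^sub>R grad3 Z x)"
      by (simp add: cross_mult_right right_diff_distrib)
    moreover have "x \<bullet> cross3 (grad3 A x) (grad3 v x) = x \<bullet> cross3 (grad3 A x) (m x *\<^sub>R grad3 Z x)"
      using coriolis_bracket_axis[OF x, of \<omega>]
      by (simp add: gv[OF x] A(2) cross_add_right inner_add_right cross_mult_right)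
    moreover have "x \<bullet> cross3 (g x) (grad3 v x) - n x * (x \<bullet> cross3 (g x) (axis 3 1)) = x \<bullet> cross3 (g x) (m x *\<^sub>R grad3 Z x)"
      by (simp add: gv[OF x] cross_add_right inner_add_right cross_mult_right)
    ultimately show ?case by simp
  qed
  then have "(\<integral>x. m x * D x + x \<bullet> cross3 (grad3 A x) (grad3 v x) \<partial>sphere_area)
      = (\<integral>x. x \<bullet> cross3 (g x) (grad3 v x) - n x * (x \<bullet> cross3 (g x) (axis 3 1)) \<partial>sphere_area)"
    using i1 i2 i3 i4 by (intro integral_cong_AE) auto
  then have "(\<integral>x. m x * D x \<partial>sphere_area) + (\<integral>x. x \<bullet> cross3 (grad3 A x) (grad3 v x) \<partial>sphere_area)
      = (\<integral>x. x \<bullet> cross3 (g x) (grad3 v x) \<partial>sphere_area) - (\<integral>x. n x * (x \<bullet> cross3 (g x) (axis 3 1)) \<partial>sphere_area)"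
    using i1 i2 i3 i4 by simp
  then show ?thesis
    by (simp add: integral_bracket[OF A(1) v] integral_bracket_green[OF green v])
qed

text \<open>The test function \<open>Z ^ k\<close> has a gradient parallel to that of
  \<open>Z\<close>, so no remainder arises.\<close>

lemma integral_power_rate: "(\<integral>x. (of_nat k * z x ^ (k - 1)) * D x \<partial>sphere_area) = 0"
  using integral_test[of "\<lambda>y. Z y ^ k" "\<lambda>x. of_nat k * z x ^ (k - 1)" "\<lambda>_. 0"]
  by (simp add: Ck_on_power Z grad3_power diff continuous_intros z_cont)

text \<open>The test function x_3 Z leaves the remainder n = z, the pairing of the vorticity with
  the rotation derivative of its own stream function, which integrates to zero.\<close>

lemma integral_momentum_rate: "(\<integral>x. x $ 3 * D x \<partial>sphere_area) = 0"
proof -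
  have "(\<integral>x. x $ 3 * D x \<partial>sphere_area) = - (\<integral>x. z x * (x \<bullet> cross3 (g x) (axis 3 1)) \<partial>sphere_area)"
  proof (rule integral_test)
    show "Ck_on k (-{0}) (\<lambda>y. y $ 3 * Z y)" for k
      by (intro Ck_on_mult Ck_on_coord Z) auto
    show "grad3 (\<lambda>y. y $ 3 * Z y) x = x $ 3 *\<^sub>R grad3 Z x + z x *\<^sub>R axis 3 1" if "x \<in> S2" for x
      using that Z(3)[OF that]
      by (simp add: grad3_mult grad3_coord diff Z bounded_linear_imp_differentiable bounded_linear_vec_nth)
  qed (intro continuous_intros z_cont)+
  then show ?thesis
    using integral_momentum_green[OF green] by simp
qed

end

section \<open>Differentiating integrals over the sphere in time\<close>

lemma
  fixes \<zeta> :: "real^3 \<Rightarrow> real \<Rightarrow> real"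
  assumes sm: "smooth_on (S2 \<times> {0..}) (\<lambda>(x, t). \<zeta> x t)" and c: "continuous_on S2 c"
  shows continuous_on_deriv_slice: "t > 0 \<Longrightarrow> continuous_on S2 (\<lambda>x. deriv (\<zeta> x) t)"
    and continuous_on_integral_power: "continuous_on {0..} (\<lambda>t. \<integral>x. c x * \<zeta> x t ^ k \<partial>sphere_area)"
    and has_derivative_integral_power: "t > 0 \<Longrightarrow>
      ((\<lambda>t. \<integral>x. c x * \<zeta> x t ^ k \<partial>sphere_area) has_real_derivative
       (\<integral>x. c x * (of_nat k * \<zeta> x t ^ (k - 1) * deriv (\<zeta> x) t) \<partial>sphere_area)) (at t)"
proof -
  obtain U F where U: "open U" "S2 \<times> {0..} \<subseteq> U" "\<And>k. Ck_on k U F"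
    "\<forall>y\<in>S2 \<times> {0..}. F y = (case y of (x, t) \<Rightarrow> \<zeta> x t)"
    using sm unfolding smooth_on_def by blast
  have F: "F (x, t) = \<zeta> x t" if "x \<in> S2" "t \<ge> 0" for x t
    using U(4) that by auto
  \<comment> \<open>The time derivative of the extension is jointly continuous on an open set
    reaching past t = 0. For t > 0 it is the derivative of \<zeta> itself, since both functions
    agree at all nearby times.\<close>
  define D where "D = (\<lambda>y. frechet_derivative F (at y) (0, 1))"
  have "Ck_on 0 U D"
    using U(3)[of 1] unfolding D_def by (simp add: Basis_prod_def)
  then have cD: "continuous_on U D" by simp
  have cF: "continuous_on U F" using U(3)[of 0] by simp
  have dF: "((\<zeta> x) has_real_derivative D (x, t)) (at t)" if "x \<in> S2" "t > 0" for x t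
  proof -
    have "(x, t) \<in> U" using that U(2) by auto
    then have d: "(F has_derivative frechet_derivative F (at (x, t))) (at (x, t))"
      using Ck_on_SucD[OF U(1,3)] by blast
    interpret linear "frechet_derivative F (at (x, t))"
      using d has_derivative_linear by blast
    have "((\<lambda>s. F (x, s)) has_derivative (\<lambda>h. frechet_derivative F (at (x, t)) (0, h))) (at t)"
      by (rule has_derivative_compose[of "\<lambda>s. (x, s)" "\<lambda>h. (0, h)" t UNIV F])
        (use d in \<open>auto intro!: derivative_eq_intros\<close>)
    moreover have "frechet_derivative F (at (x, t)) (0, h) = D (x, t) * h" for h
      using scaleR[of h "(0, 1)"] by (simp add: D_def)
    ultimately have "((\<lambda>s. F (x, s)) has_real_derivative D (x, t)) (at t)"
      by (simp add: has_field_derivative_def)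
    then show ?thesis
      by (rule has_field_derivative_transform_within_open[of _ _ _ "{0<..}"]) (use that F in auto)
  qed
  have deriv: "deriv (\<zeta> x) t = D (x, t)" if "x \<in> S2" "t > 0" for x t
    using dF[OF that] by (rule DERIV_imp_deriv)
  have sD: "continuous_on S2 (\<lambda>x. D (x, t))" "continuous_on S2 (\<lambda>x. F (x, t))" if "t \<ge> 0" for t
    using U(2) that by (auto intro!: continuous_on_compose2[OF cD] continuous_on_compose2[OF cF] continuous_intros)
  show 1: "continuous_on S2 (\<lambda>x. deriv (\<zeta> x) t)" if "t > 0" for t
    using sD(1)[of t] that by (simp add: deriv cong: continuous_on_cong_simp)
  have s\<zeta>: "continuous_on S2 (\<lambda>x. \<zeta> x t)" if "t \<ge> 0" for t
    using sD(2)[OF that] that by (simp add: F cong: continuous_on_cong_simp)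
  define f where "f t z = cos (snd z) * (c (spherical z) * F (spherical z, t) ^ k)" for t z
  define f' where "f' t z = cos (snd z) * (c (spherical z) * (of_nat k * F (spherical z, t) ^ (k - 1) * D (spherical z, t)))" for t z
  have E: "(\<integral>x. c x * \<zeta> x t ^ k \<partial>sphere_area) = integral rect (f t)" if "t \<ge> 0" for t
    unfolding f_def using that
    by (subst integral_continuous_S2) (auto intro!: continuous_intros c s\<zeta> simp: F)
  have E': "(\<integral>x. c x * (of_nat k * \<zeta> x t ^ (k - 1) * deriv (\<zeta> x) t) \<partial>sphere_area) = integral rect (f' t)"
    if "t > 0" for t
    unfolding f'_def using that
    by (subst integral_continuous_S2) (auto intro!: continuous_intros c s\<zeta> 1 simp: F deriv)
  have cc: "continuous_on A (\<lambda>y. c (spherical (snd y)))" for A :: "(real \<times> real \<times> real) set"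
    by (rule continuous_on_compose2[OF c]) (auto intro!: continuous_intros continuous_on_compose2[OF continuous_on_spherical])
  have cG: "continuous_on ({0..} \<times> rect) (\<lambda>y. G (spherical (snd y), fst y))" if "continuous_on U G" for G :: "_ \<Rightarrow> real"
    by (rule continuous_on_compose2[OF that])
      (use U(2) in \<open>auto intro!: continuous_intros continuous_on_compose2[OF continuous_on_spherical]\<close>)
  have cf: "continuous_on ({0..} \<times> rect) (\<lambda>(t, z). f t z)"
    unfolding f_def case_prod_beta by (intro continuous_intros cc cG[OF cF])
  have cf': "continuous_on ({0..} \<times> rect) (\<lambda>(t, z). f' t z)"
    unfolding f'_def case_prod_beta by (intro continuous_intros cc cG[OF cF] cG[OF cD])
  have "continuous_on {0..} (\<lambda>t. integral rect (f t))"
    using cf by (rule integral_continuous_on_param)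
  then show "continuous_on {0..} (\<lambda>t. \<integral>x. c x * \<zeta> x t ^ k \<partial>sphere_area)"
    by (rule continuous_on_eq) (simp add: E)
  show "((\<lambda>t. \<integral>x. c x * \<zeta> x t ^ k \<partial>sphere_area) has_real_derivative
       (\<integral>x. c x * (of_nat k * \<zeta> x t ^ (k - 1) * deriv (\<zeta> x) t) \<partial>sphere_area)) (at t)" if t: "t > 0"
  proof -
    \<comment> \<open>The Leibniz rule is applied within the open half-line, a convex set on which
      the derivative within the set is the ordinary one.\<close>
    have "((\<lambda>t. integral rect (f t)) has_real_derivative integral rect (f' t)) (at t within {0<..})"
    proof (rule leibniz_rule_field_derivative)
      show "((\<lambda>t. f t z) has_real_derivative f' t z) (at t within {0<..})" if "t \<in> {0<..}" for t z
      proof -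
        have t: "t > 0" using that by simp
        have "((\<lambda>s. F (spherical z, s)) has_real_derivative D (spherical z, t)) (at t)"
          by (rule has_field_derivative_transform_within_open[OF dF[OF spherical_in_S2 t], of "{0<..}"])
            (use t F in auto)
        then have "((\<lambda>t. f t z) has_real_derivative f' t z) (at t)"
          unfolding f_def f'_def
          by (auto intro!: derivative_eq_intros)
        then show ?thesis by (rule has_field_derivative_at_within)
      qed
      show "f t integrable_on rect" if "t \<in> {0<..}" for t
      proof (rule integrable_continuous)
        show "continuous_on rect (f t)"
        proof -
          have "continuous_on rect (\<lambda>z. (t, z))" by (intro continuous_intros)
          moreover have "(\<lambda>z. (t, z)) ` rect \<subseteq> {0..} \<times> rect"
            unfolding image_subset_iff using that by simp
          ultimately show ?thesis
            using continuous_on_compose2[OF cf, of rect "\<lambda>z. (t, z)"] by simp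
        qed
      qed
      show "continuous_on ({0<..} \<times> rect) (\<lambda>(t, z). f' t z)"
        by (rule continuous_on_subset[OF cf']) auto
    qed (use t in auto)
    then have "((\<lambda>t. integral rect (f t)) has_real_derivative integral rect (f' t)) (at t)"
      using t by (simp add: at_within_open[of t "{0<..}"])
    then show ?thesis
      unfolding E'[OF t]
      by (rule has_field_derivative_transform_within_open[of _ _ _ "{0<..}"]) (use t E in auto)
  qed
qed

text \<open>Both laws are instances of one claim with a weight \<open>c\<close> and a power
  \<open>k\<close>: weight 1, or weight x_3 with k = 1. The equation is available for positive times
  only, so continuity at 0 ties the constant value to the initial data.\<close>

lemma
  assumes "smooth_solution \<omega> \<zeta>" "t \<ge> 0"
  shows smooth_solution_conserves_power:
      "(\<integral>x. \<zeta> x t ^ k \<partial>sphere_area) = (\<integral>x. \<zeta> x 0 ^ k \<partial>sphere_area)"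
    and smooth_solution_conserves_momentum:
      "(\<integral>x. x $ 3 * \<zeta> x t \<partial>sphere_area) = (\<integral>x. x $ 3 * \<zeta> x 0 \<partial>sphere_area)"
proof -
  have sm: "smooth_on (S2 \<times> {0..}) (\<lambda>(x, t). \<zeta> x t)"
    using assms by (simp add: smooth_solution_def)
  have slice: "smooth_on S2 (\<lambda>x. \<zeta> x s)" if "s > 0" for s
    using smooth_on_time_slice[OF sm] that by simp
  have rate: "(\<integral>x. (of_nat k * \<zeta> x s ^ (k - 1)) * deriv (\<zeta> x) s \<partial>sphere_area) = 0"
     "(\<integral>x. x $ 3 * deriv (\<zeta> x) s \<partial>sphere_area) = 0" if s: "s > 0" for s k
  proof -
    obtain \<psi> g where gr: "\<forall>r>1. green r (\<lambda>x. \<zeta> x s) \<psi> g" and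
      eq: "AE x in sphere_area.
           deriv (\<lambda>s. \<zeta> x s) s
           + rot_J x (grad_S (\<lambda>y. \<omega> * y $ 3) x - g x) \<bullet> grad_S (\<lambda>y. \<zeta> y s) x = 0"
      using assms s unfolding smooth_solution_def by blast
    have "green 2 (\<lambda>x. \<zeta> x s) \<psi> g" using gr by simp
    note * = slice[OF s] continuous_on_deriv_slice[OF sm continuous_on_const s] this eq
    show "(\<integral>x. (of_nat k * \<zeta> x s ^ (k - 1)) * deriv (\<zeta> x) s \<partial>sphere_area) = 0"
      by (rule integral_power_rate[OF *])
    show "(\<integral>x. x $ 3 * deriv (\<zeta> x) s \<partial>sphere_area) = 0"
      by (rule integral_momentum_rate[OF *])
  qed
  have const: "(\<integral>x. c x * \<zeta> x t ^ k \<partial>sphere_area) = (\<integral>x. c x * \<zeta> x 0 ^ k \<partial>sphere_area)"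
    if c: "continuous_on S2 c"
      and 0: "\<And>s. s > 0 \<Longrightarrow> (\<integral>x. c x * (of_nat k * \<zeta> x s ^ (k - 1) * deriv (\<zeta> x) s) \<partial>sphere_area) = 0"
    for c k
  proof (cases "t = 0")
    case False
    show ?thesis
    proof (rule DERIV_isconst_end[where a = 0 and b = t and f = "\<lambda>t. \<integral>x. c x * \<zeta> x t ^ k \<partial>sphere_area"])
      show "0 < t" using False assms(2) by simp
      show "continuous_on {0..t} (\<lambda>t. \<integral>x. c x * \<zeta> x t ^ k \<partial>sphere_area)"
        using continuous_on_integral_power[OF sm c] by (rule continuous_on_subset) auto
      show "((\<lambda>t. \<integral>x. c x * \<zeta> x t ^ k \<partial>sphere_area) has_real_derivative 0) (at s)" if "0 < s" "s < t" for s
        using has_derivative_integral_power[OF sm c that(1), of k] 0[OF that(1)] by simp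
    qed
  qed simp
  show "(\<integral>x. \<zeta> x t ^ k \<partial>sphere_area) = (\<integral>x. \<zeta> x 0 ^ k \<partial>sphere_area)"
    using const[of "\<lambda>_. 1" k] rate(1) by simp
  show "(\<integral>x. x $ 3 * \<zeta> x t \<partial>sphere_area) = (\<integral>x. x $ 3 * \<zeta> x 0 \<partial>sphere_area)"
    using const[of "\<lambda>x. x $ 3" 1] rate(2) by (simp add: continuous_intros)
qed

text \<open>Equal moments mean equal integrals for all polynomials. A single polynomial approximates
  \<open>F\<close> uniformly on the compact union of both ranges, at the cost of one error for each
  function.\<close>

lemma integral_comp_eq_of_moments:
  fixes f g :: "real^3 \<Rightarrow> real" and F :: "real \<Rightarrow> real"
  assumes f: "continuous_on S2 f" and g: "continuous_on S2 g" and F: "continuous_on UNIV F"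
    and mom: "\<And>k. (\<integral>x. f x ^ k \<partial>sphere_area) = (\<integral>x. g x ^ k \<partial>sphere_area)"
  shows "(\<integral>x. F (f x) \<partial>sphere_area) = (\<integral>x. F (g x) \<partial>sphere_area)"
proof -
  let ?K = "f ` S2 \<union> g ` S2"
  let ?\<mu> = "measure sphere_area S2"
  have K: "compact ?K"
    by (intro compact_Un compact_continuous_image f g compact_sphere)
  have bound: "\<bar>(\<integral>x. F (f x) \<partial>sphere_area) - (\<integral>x. F (g x) \<partial>sphere_area)\<bar> \<le> 2 * ?\<mu> * e" if e: "e > 0" for e
  proof -
    obtain P where P: "real_polynomial_function P" "\<And>x. x \<in> ?K \<Longrightarrow> \<bar>F x - P x\<bar> < e"
      using Stone_Weierstrass_real_polynomial_function[OF K continuous_on_subset[OF F subset_UNIV] e] by blast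
    obtain a n where Pa: "P = (\<lambda>x. \<Sum>i\<le>n. a i * x ^ i)"
      using P(1) unfolding real_polynomial_function_iff_sum by blast
    have ip: "integrable sphere_area (\<lambda>x. a i * h x ^ i)" if "continuous_on S2 h" for h i
      by (intro integrable_continuous_S2 continuous_intros that)
    have Ph: "(\<integral>x. P (h x) \<partial>sphere_area) = (\<Sum>i\<le>n. a i * (\<integral>x. h x ^ i \<partial>sphere_area))" if "continuous_on S2 h" for h
      unfolding Pa using ip[OF that] by simp
    have d: "\<bar>(\<integral>x. F (h x) \<partial>sphere_area) - (\<integral>x. P (h x) \<partial>sphere_area)\<bar> \<le> ?\<mu> * e"
      if h: "continuous_on S2 h" "h ` S2 \<subseteq> ?K" for h
    proof -
      have I: "integrable sphere_area (\<lambda>x. F (h x))" "integrable sphere_area (\<lambda>x. P (h x))"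
        unfolding Pa by (intro integrable_continuous_S2 continuous_intros h continuous_on_compose2[OF F]; auto)+
      have "\<bar>(\<integral>x. F (h x) - P (h x) \<partial>sphere_area)\<bar> \<le> (\<integral>x. \<bar>F (h x) - P (h x)\<bar> \<partial>sphere_area)"
        by (rule integral_abs_bound)
      also have "\<dots> \<le> (\<integral>x. e \<partial>sphere_area)"
        using P(2) h(2) by (intro integral_mono integrable_abs Bochner_Integration.integrable_diff I)
          (auto simp: less_imp_le image_subset_iff)
      finally show ?thesis using I by (simp add: mult.commute)
    qed
    show ?thesis
      using d[OF f] d[OF g] Ph[OF f] Ph[OF g] mom by auto
  qed
  have "\<bar>(\<integral>x. F (f x) \<partial>sphere_area) - (\<integral>x. F (g x) \<partial>sphere_area)\<bar> \<le> 0"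
  proof (rule field_le_epsilon)
    fix e :: real assume e: "e > 0"
    have \<mu>: "0 \<le> ?\<mu>" by simp
    \<comment> \<open>The added 1 keeps the denominator positive without a lower bound on the
      area.\<close>
    then have pos: "0 < 2 * ?\<mu> + 1" by linarith
    then have "2 * ?\<mu> * (e / (2 * ?\<mu> + 1)) \<le> e" "0 < e / (2 * ?\<mu> + 1)"
      using e pos by (simp_all add: pos_divide_le_eq distrib_left mult.commute)
    with bound[of "e / (2 * ?\<mu> + 1)"]
    show "\<bar>(\<integral>x. F (f x) \<partial>sphere_area) - (\<integral>x. F (g x) \<partial>sphere_area)\<bar> \<le> 0 + e" by linarith
  qed
  then show ?thesis by simp
qed

section \<open>The convex conjugate of a monotone profile\<close>

text \<open>The convex function \<open>F\<close> plays the role of the Legendre transform of a primitive of \<open>h\<close>: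
  its derivative is a generalised inverse of \<open>h\<close> with values in \<open>[-1,1]\<close>, which makes it
  Lipschitz however fast \<open>h\<close> grows.\<close>

lemma mono_profile_conjugate:
  fixes h :: "real \<Rightarrow> real"
  assumes h: "mono_on {-1<..<1} h"
  obtains F :: "real \<Rightarrow> real" where
    "\<And>a b. \<bar>F a - F b\<bar> \<le> \<bar>a - b\<bar>"
    "\<And>s y. s \<in> {-1<..<1} \<Longrightarrow> s * (y - h s) \<le> F y - F (h s)"
    "\<And>s \<eta>. s \<in> {-1<..<1} \<Longrightarrow> isCont h s \<Longrightarrow> \<eta> > 0 \<Longrightarrow>
      \<exists>c>0. \<forall>y. \<bar>y - h s\<bar> \<ge> \<eta> \<longrightarrow> c \<le> F y - F (h s) - s * (y - h s)"
proof -
  \<comment> \<open>The point -1 keeps the set nonempty when y lies below all values of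
    \<open>h\<close>, and then serves as the value of the inverse.\<close>
  define S where "S y = insert (-1) {s\<in>{-1<..<1}. h s \<le> y}" for y
  define k where "k y = Sup (S y)" for y
  have bdd: "bdd_above (S y)" for y
    by (rule bdd_aboveI[of _ 1]) (auto simp: S_def)
  have k_ge: "s \<le> k y" if "s \<in> {-1<..<1}" "h s \<le> y" for s y
    unfolding k_def by (rule cSup_upper[OF _ bdd]) (use that in \<open>auto simp: S_def\<close>)
  have k_le: "k y \<le> s" if "s \<in> {-1<..<1}" "y < h s" for s y
    unfolding k_def
  proof (rule cSup_least)
    fix u assume "u \<in> S y"
    then show "u \<le> s"
      using that mono_onD[OF h, of s u] by (cases "u \<le> s") (auto simp: S_def)
  qed (auto simp: S_def)
  have k_bounds: "-1 \<le> k y" "k y \<le> 1" for y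
    unfolding k_def by (rule cSup_upper[OF _ bdd] cSup_least; auto simp: S_def)+
  have "mono k"
    unfolding k_def by (intro monoI cSup_subset_mono bdd) (auto simp: S_def)
  then have ki: "k integrable_on {a..b}" for a b
    by (intro integrable_on_mono_on) (auto simp: mono_on_def mono_def)
  \<comment> \<open>The primitive of \<open>k\<close> vanishing at 0. The cases are needed because
    the integral over {0..y} is zero for negative y.\<close>
  define F where "F y = (if 0 \<le> y then integral {0..y} k else - integral {y..0} k)" for y
  have F_diff: "F b - F a = integral {a..b} k" if "a \<le> b" for a b
  proof -
    have "integral {a..c} k + integral {c..b} k = integral {a..b} k" if "a \<le> c" "c \<le> b" for a b c
      by (rule Henstock_Kurzweil_Integration.integral_combine[OF that ki])
    from this[of 0 a b] this[of a 0 b] this[of a b 0] that show ?thesis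
      by (auto simp: F_def)
  qed
  \<comment> \<open>Only interior points are asked for, since \<open>k_le\<close> needs a strict
    inequality and gives nothing at the endpoint y = h s.\<close>
  have slope: "m * (b - a) \<le> F b - F a \<and> F b - F a \<le> M * (b - a)"
    if "a \<le> b" "\<And>z. a < z \<Longrightarrow> z < b \<Longrightarrow> m \<le> k z \<and> k z \<le> M" for a b m M
  proof -
    have "integral {a<..<b} (\<lambda>_. m) \<le> integral {a<..<b} k" "integral {a<..<b} k \<le> integral {a<..<b} (\<lambda>_. M)"
      using ki that(2) by (auto intro!: integral_le simp: integrable_on_open_interval_real)
    moreover have "integral {a<..<b} (\<lambda>_. c) = c * (b - a)" for c :: real
      using that(1) by (simp add: integral_open_interval_real[symmetric] mult.commute)
    ultimately show ?thesis
      using that(1) by (simp add: F_diff integral_open_interval_real)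
  qed
  have lip: "\<bar>F a - F b\<bar> \<le> \<bar>a - b\<bar>" for a b
    using slope[of a b "-1" 1] slope[of b a "-1" 1] k_bounds by (cases "a \<le> b") auto
  \<comment> \<open>The slope \<open>k\<close> is at least s to the right of h s and at most s to
    the left, so s is a subgradient of \<open>F\<close> at h s.\<close>
  have sub: "s * (y - h s) \<le> F y - F (h s)" if s: "s \<in> {-1<..<1}" for s y
  proof (cases "h s \<le> y")
    case True
    have "s \<le> k z \<and> k z \<le> 1" if "h s < z" for z
      using k_ge[OF s, of z] k_bounds that by auto
    from slope[OF True, of s 1] this show ?thesis by blast
  next
    case False
    have "-1 \<le> k z \<and> k z \<le> s" if "z < h s" for z
      using k_le[OF s, of z] k_bounds that by auto
    with slope[of y "h s" "-1" s] False have "F (h s) - F y \<le> s * (h s - y)" by force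
    then show ?thesis by (simp add: algebra_simps)
  qed
  have gap: "\<exists>c>0. \<forall>y. \<bar>y - h s\<bar> \<ge> \<eta> \<longrightarrow> c \<le> F y - F (h s) - s * (y - h s)"
    if s: "s \<in> {-1<..<1}" and "isCont h s" and \<eta>: "\<eta> > 0" for s \<eta>
  proof -
    obtain d where d: "d > 0" "\<And>u. dist u s < d \<Longrightarrow> dist (h u) (h s) < \<eta> / 2"
      using \<open>isCont h s\<close> \<eta> unfolding continuous_at_eps_delta by (meson half_gt_zero)
    \<comment> \<open>Small enough for s + e and s - e to stay in the open interval and within the
      continuity radius d of s.\<close>
    define e where "e = min (d / 2) (min ((1 - s) / 2) ((1 + s) / 2))"
    have e: "e > 0" "s + e \<in> {-1<..<1}" "s - e \<in> {-1<..<1}" "e < d"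
      using s d(1) by (auto simp: e_def min_def field_simps)
    have "dist (h (s + e)) (h s) < \<eta> / 2" "dist (h (s - e)) (h s) < \<eta> / 2"
      by (rule d(2); use e in \<open>simp add: dist_real_def\<close>)+
    then have hr: "h (s + e) < h s + \<eta> / 2" and hl: "h s - \<eta> / 2 < h (s - e)"
      unfolding dist_real_def by linarith+
    \<comment> \<open>By continuity the values of \<open>h\<close> at s + e and s - e are within
      \<eta>/2 of h s. Beyond that distance the slope of \<open>F\<close> differs from s by at least
      e, and this excess accumulates over a further length of at least \<eta>/2.\<close>
    have "e * (\<eta> / 2) \<le> F y - F (h s) - s * (y - h s)" if "\<bar>y - h s\<bar> \<ge> \<eta>" for y
    proof (cases "y \<ge> h s")
      case True
      define m where "m = h s + \<eta> / 2"
      have y: "m \<le> y" "\<eta> / 2 \<le> y - m" using True that \<eta> by (auto simp: m_def)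
      have "s + e \<le> k z \<and> k z \<le> 1" if "m < z" for z
        using k_ge[OF e(2), of z] k_bounds that hr by (auto simp: m_def)
      with slope[OF y(1), of "s + e" 1] have "(s + e) * (y - m) \<le> F y - F m" by blast
      with sub[OF s, of m] have "e * (y - m) \<le> F y - F (h s) - s * (y - h s)"
        by (simp add: algebra_simps)
      moreover have "e * (\<eta> / 2) \<le> e * (y - m)" using e y by (intro mult_left_mono) auto
      ultimately show ?thesis by linarith
    next
      case False
      define m where "m = h s - \<eta> / 2"
      have y: "y \<le> m" "\<eta> / 2 \<le> m - y" using False that \<eta> by (auto simp: m_def)
      have "-1 \<le> k z \<and> k z \<le> s - e" if "z < m" for z
        using k_le[OF e(3), of z] k_bounds that hl by (auto simp: m_def)
      with slope[OF y(1), of "-1" "s - e"] have "F m - F y \<le> (s - e) * (m - y)" by blast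
      with sub[OF s, of m] have "e * (m - y) \<le> F y - F (h s) - s * (y - h s)"
        by (simp add: algebra_simps)
      moreover have "e * (\<eta> / 2) \<le> e * (m - y)" using e y by (intro mult_left_mono) auto
      ultimately show ?thesis by linarith
    qed
    moreover have "e * (\<eta> / 2) > 0" using e \<eta> by simp
    ultimately show ?thesis by blast
  qed
  show thesis using that[OF lip sub gap] by blast
qed

text \<open>A circle of latitude lies on the line \<theta> = arcsin c of the coordinate rectangle,
  which is null. This disposes of the poles and of each discontinuity of the profile.\<close>

lemma AE_sphere_area_height_neq: "AE x in sphere_area. x $ 3 \<noteq> c"
proof -
  have m: "{x \<in> S2. x $ 3 \<noteq> c} \<in> sets (restrict_space borel S2)"
  proof -
    have "{x :: real^3. x $ 3 \<noteq> c} \<in> sets borel"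
      by (intro borel_open open_Collect_neq continuous_intros)
    then show ?thesis
      by (auto simp: sets_restrict_space)
  qed
  have "negligible {z::real \<times> real. z \<bullet> (0, 1) = arcsin c}"
    by (rule negligible_standard_hyperplane) (simp add: Basis_prod_def)
  then have "negligible {z::real \<times> real. snd z = arcsin c}"
    by (simp add: inner_prod_def)
  moreover have "{z::real \<times> real. snd z = arcsin c} \<in> sets lborel"
    by (simp, intro borel_closed closed_Collect_eq continuous_intros)
  ultimately have "{z::real \<times> real. snd z = arcsin c} \<in> null_sets lborel"
    by (simp add: negligible_iff_null_sets null_sets_completion_iff)
  then have "AE z in lborel. z \<notin> {z::real \<times> real. snd z = arcsin c}"
    by (rule AE_not_in)
  then have "AE z in lborel. sphere_dens z > 0 \<longrightarrow> spherical z $ 3 \<noteq> c"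
  proof eventually_elim
    case (elim z)
    show ?case
    proof
      assume "sphere_dens z > 0"
      moreover have "sphere_dens z = cos (snd z) * indicator rect z"
        by (simp add: sphere_dens_def case_prod_beta')
      ultimately have "indicator rect z \<noteq> (0::real)" by force
      then have "z \<in> rect" by (metis indicator_simps(2))
      then have "snd z \<in> {-(pi/2)..pi/2}"
        unfolding rect_eq by auto
      then have "arcsin (sin (snd z)) = snd z"
        by (intro arcsin_sin) auto
      then show "spherical z $ 3 \<noteq> c"
        using elim by (cases z) auto
    qed
  qed
  then show ?thesis using AE_sphere_area_iff[OF m] by simp
qed

text \<open>This is the Mazur map sgn(y) |y|^p, which carries L^p into L^1. Written with positive
  and negative parts it involves only powers of nonnegative bases, which makes its continuity
  immediate.\<close>

definition signed_powr :: "real \<Rightarrow> real \<Rightarrow> real" where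
  "signed_powr p y = max y 0 powr p - max (- y) 0 powr p"

lemma abs_signed_powr: "\<bar>signed_powr p y\<bar> = \<bar>y\<bar> powr p"
  by (cases "0 \<le> y") (auto simp: signed_powr_def)

lemma continuous_on_signed_powr: "p > 0 \<Longrightarrow> continuous_on A (signed_powr p)"
  unfolding signed_powr_def by (intro continuous_intros continuous_on_powr') auto

section \<open>Elementary inequalities for p-th powers\<close>

lemma powr_diff_le:
  fixes a b p :: real
  assumes "p \<ge> 1" "0 \<le> b" "b \<le> a"
  shows "(a - b) powr p \<le> a powr p - b powr p"
proof (cases "a = 0")
  case False
  \<comment> \<open>Superadditivity of the p-th power: one factor is split off, and the remaining
    power p - 1 is non-decreasing.\<close>
  have split: "x powr p = x powr (p - 1) * x" if "0 \<le> x" for x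
    using that assms(1) powr_mult_base[of x "p - 1"] by (simp add: mult.commute)
  have "(a - b) powr p + b powr p = (a - b) powr (p - 1) * (a - b) + b powr (p - 1) * b"
    using assms by (simp add: split)
  also have "\<dots> \<le> a powr (p - 1) * (a - b) + a powr (p - 1) * b"
    using assms by (intro add_mono mult_right_mono powr_mono2) auto
  also have "\<dots> = a powr p"
    using assms by (simp add: split algebra_simps)
  finally show ?thesis by simp
qed (use assms in auto)

text \<open>For equal signs this is superadditivity. For opposite signs |a - b| is a sum of absolute
  values, at most twice the larger one; the factor 2 powr p comes from here.\<close>

lemma powr_abs_diff_le_signed_powr:
  fixes a b p :: real
  assumes p: "p \<ge> 1"
  shows "\<bar>a - b\<bar> powr p \<le> 2 powr p * \<bar>signed_powr p a - signed_powr p b\<bar>"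
proof -
  have two: "1 \<le> 2 powr p" using p by (simp add: ge_one_powr_ge_zero)
  have same: "\<bar>a - b\<bar> powr p \<le> 2 powr p * \<bar>a powr p - b powr p\<bar>" if "0 \<le> a" "0 \<le> b" for a b :: real
  proof -
    have "\<bar>a - b\<bar> powr p \<le> \<bar>a powr p - b powr p\<bar>"
      using powr_diff_le[OF p, of b a] powr_diff_le[OF p, of a b] that
      by (cases "b \<le> a") (auto simp: abs_minus_commute)
    also have "\<dots> \<le> 2 powr p * \<bar>a powr p - b powr p\<bar>"
      using mult_right_mono[OF two, of "\<bar>a powr p - b powr p\<bar>"] by simp
    finally show ?thesis .
  qed
  have opp: "(a + b) powr p \<le> 2 powr p * (a powr p + b powr p)" if "0 \<le> a" "0 \<le> b" for a b :: real
  proof -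
    have "(a + b) powr p \<le> (2 * max a b) powr p"
      using that p by (intro powr_mono2) auto
    also have "\<dots> = 2 powr p * max a b powr p"
      by (rule powr_mult)
    also have "\<dots> \<le> 2 powr p * (a powr p + b powr p)"
      by (intro mult_left_mono) (auto simp: max_def)
    finally show ?thesis .
  qed
  consider "0 \<le> a" "0 \<le> b" | "a < 0" "b < 0" | "0 \<le> a" "b < 0" | "a < 0" "0 \<le> b" by linarith
  then show ?thesis
  proof cases
    case 1
    then show ?thesis using same[of a b] by (simp add: signed_powr_def)
  next
    case 2
    then show ?thesis using same[of "-b" "-a"] by (simp add: signed_powr_def)
  next
    case 3
    then show ?thesis using opp[of a "-b"] by (simp add: signed_powr_def)
  next
    case 4
    then have "\<bar>signed_powr p a - signed_powr p b\<bar> = (- a) powr p + b powr p" "\<bar>a - b\<bar> = - a + b"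
      by (simp_all add: signed_powr_def abs_minus_commute[of "- ((- a) powr p)"])
    then show ?thesis using opp[of "-a" b] 4 by simp
  qed
qed

text \<open>Either |a| is at most (1 + \<eta>) |b|, or a differs from b by a fixed proportion of
  |a|. The coefficient of |b| powr p can be brought arbitrarily close to 1.\<close>

lemma powr_le_perturbed:
  fixes a b p \<eta> :: real
  assumes p: "p \<ge> 1" and \<eta>: "\<eta> > 0"
  shows "\<bar>a\<bar> powr p \<le> (1 + \<eta>) powr p * \<bar>b\<bar> powr p + ((1 + \<eta>) / \<eta>) powr p * \<bar>a - b\<bar> powr p"
proof (cases "\<bar>a\<bar> \<le> (1 + \<eta>) * \<bar>b\<bar>")
  case True
  then have "\<bar>a\<bar> powr p \<le> ((1 + \<eta>) * \<bar>b\<bar>) powr p"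
    using p by (intro powr_mono2) auto
  also have "\<dots> = (1 + \<eta>) powr p * \<bar>b\<bar> powr p"
    by (rule powr_mult)
  finally show ?thesis
    using mult_nonneg_nonneg[OF powr_ge_zero[of "(1 + \<eta>) / \<eta>" p] powr_ge_zero[of "\<bar>a - b\<bar>" p]] by linarith
next
  case False
  then have "\<eta> * \<bar>a\<bar> \<le> (1 + \<eta>) * (\<bar>a\<bar> - \<bar>b\<bar>)" by (simp add: algebra_simps)
  also have "\<dots> \<le> (1 + \<eta>) * \<bar>a - b\<bar>" using \<eta> by (intro mult_left_mono) auto
  finally have "\<bar>a\<bar> \<le> (1 + \<eta>) / \<eta> * \<bar>a - b\<bar>" using \<eta> by (simp add: field_simps)
  then have "\<bar>a\<bar> powr p \<le> ((1 + \<eta>) / \<eta> * \<bar>a - b\<bar>) powr p"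
    using p by (intro powr_mono2) auto
  also have "\<dots> = ((1 + \<eta>) / \<eta>) powr p * \<bar>a - b\<bar> powr p"
    by (rule powr_mult)
  finally show ?thesis
    using mult_nonneg_nonneg[OF powr_ge_zero[of "1 + \<eta>" p] powr_ge_zero[of "\<bar>b\<bar>" p]] by linarith
qed

text \<open>Above the threshold \<eta> the power 1 - p is non-positive, so |a| powr (1 - p) is at
  most \<eta> powr (1 - p). On a space of finite measure this takes the place of Hoelder's
  inequality.\<close>

lemma abs_le_powr:
  fixes a p \<eta> :: real
  assumes p: "p \<ge> 1" and \<eta>: "\<eta> > 0"
  shows "\<bar>a\<bar> \<le> \<eta> + \<eta> powr (1 - p) * \<bar>a\<bar> powr p"
proof (cases "\<bar>a\<bar> \<le> \<eta>")
  case True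
  then show ?thesis by (simp add: add_increasing2)
next
  case False
  then have "\<bar>a\<bar> = \<bar>a\<bar> powr (1 - p) * \<bar>a\<bar> powr p"
    using \<eta> by (simp add: powr_add[symmetric])
  also have "\<dots> \<le> \<eta> powr (1 - p) * \<bar>a\<bar> powr p"
    using False p \<eta> by (intro mult_right_mono powr_mono2') auto
  finally show ?thesis using \<eta> by linarith
qed

section \<open>Stability\<close>

lemma integrable_powr_diff:
  fixes f g :: "real^3 \<Rightarrow> real"
  assumes p: "p \<ge> 1" and f: "continuous_on S2 f" and g: "in_Lp p g"
  shows "integrable sphere_area (\<lambda>x. \<bar>f x - g x\<bar> powr p)"
proof (rule Bochner_Integration.integrable_bound)
  have [measurable]: "f \<in> borel_measurable sphere_area" "g \<in> borel_measurable sphere_area"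
    using borel_measurable_continuous_S2[OF f] g by (auto simp: in_Lp_def)
  show "(\<lambda>x. \<bar>f x - g x\<bar> powr p) \<in> borel_measurable sphere_area" by measurable
  have "integrable sphere_area (\<lambda>x. \<bar>f x\<bar> powr p)"
    using p by (intro integrable_continuous_S2 continuous_on_powr' continuous_intros f) auto
  then show "integrable sphere_area (\<lambda>x. 2 powr p * (\<bar>f x\<bar> powr p + \<bar>g x\<bar> powr p))"
    using g by (simp add: in_Lp_def)
  have "\<bar>a - b\<bar> powr p \<le> 2 powr p * (\<bar>a\<bar> powr p + \<bar>b\<bar> powr p)" for a b :: real
  proof -
    have "\<bar>signed_powr p a - signed_powr p b\<bar> \<le> \<bar>a\<bar> powr p + \<bar>b\<bar> powr p"
      using abs_triangle_ineq4[of "signed_powr p a" "signed_powr p b"] by (simp add: abs_signed_powr)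
    with powr_abs_diff_le_signed_powr[OF p, of a b] show ?thesis
      by (meson mult_left_mono order_trans powr_ge_zero)
  qed
  then show "AE x in sphere_area. norm (\<bar>f x - g x\<bar> powr p) \<le> norm (2 powr p * (\<bar>f x\<bar> powr p + \<bar>g x\<bar> powr p))"
    by simp
qed

lemma in_Lp_imp_integrable:
  fixes f :: "real^3 \<Rightarrow> real"
  assumes "p \<ge> 1" "in_Lp p f"
  shows "integrable sphere_area f"
proof (rule Bochner_Integration.integrable_bound)
  show "integrable sphere_area (\<lambda>x. 1 + \<bar>f x\<bar> powr p)"
    using assms(2) by (simp add: in_Lp_def)
  show "AE x in sphere_area. norm (f x) \<le> norm (1 + \<bar>f x\<bar> powr p)"
    using abs_le_powr[OF assms(1), of 1] by simp
qed (use assms in \<open>simp add: in_Lp_def\<close>)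

lemma L1_tendsto_of_Lp_tendsto:
  fixes f :: "nat \<Rightarrow> real^3 \<Rightarrow> real"
  assumes p: "p \<ge> 1" and i: "\<And>n. integrable sphere_area (f n)" "\<And>n. integrable sphere_area (\<lambda>x. \<bar>f n x\<bar> powr p)"
    and lim: "(\<lambda>n. \<integral>x. \<bar>f n x\<bar> powr p \<partial>sphere_area) \<longlonglongrightarrow> 0"
  shows "(\<lambda>n. \<integral>x. \<bar>f n x\<bar> \<partial>sphere_area) \<longlonglongrightarrow> 0"
proof (rule LIMSEQ_I)
  fix e :: real assume e: "e > 0"
  define \<mu> where "\<mu> = measure sphere_area S2"
  \<comment> \<open>The constant term of \<open>abs_le_powr\<close> then integrates to less than
    e/2; the added 1 excludes division by zero.\<close>
  define \<eta> where "\<eta> = e / (2 * (\<mu> + 1))"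
  have \<mu>: "\<mu> \<ge> 0" by (simp add: \<mu>_def)
  have \<eta>: "\<eta> > 0" "\<eta> * \<mu> < e / 2"
    using e \<mu> by (auto simp: \<eta>_def field_simps)
  have "(\<lambda>n. \<eta> powr (1 - p) * (\<integral>x. \<bar>f n x\<bar> powr p \<partial>sphere_area)) \<longlonglongrightarrow> 0"
    using tendsto_mult_right_zero[OF lim] .
  then obtain N where N: "\<And>n. n \<ge> N \<Longrightarrow> \<eta> powr (1 - p) * (\<integral>x. \<bar>f n x\<bar> powr p \<partial>sphere_area) < e / 2"
    using order_tendstoD(2)[of _ 0 sequentially "e / 2"] e unfolding eventually_sequentially by (metis half_gt_zero)
  show "\<exists>N. \<forall>n\<ge>N. norm ((\<integral>x. \<bar>f n x\<bar> \<partial>sphere_area) - 0) < e"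
  proof (intro exI allI impI)
    fix n assume n: "n \<ge> N"
    have "(\<integral>x. \<bar>f n x\<bar> \<partial>sphere_area) \<le> (\<integral>x. \<eta> + \<eta> powr (1 - p) * \<bar>f n x\<bar> powr p \<partial>sphere_area)"
      using i abs_le_powr[OF p \<eta>(1)] by (intro integral_mono) auto
    also have "\<dots> = \<eta> * \<mu> + \<eta> powr (1 - p) * (\<integral>x. \<bar>f n x\<bar> powr p \<partial>sphere_area)"
      using i by (simp add: \<mu>_def)
    also have "\<dots> < e" using N[OF n] \<eta> by linarith
    finally show "norm ((\<integral>x. \<bar>f n x\<bar> \<partial>sphere_area) - 0) < e"
      by (simp add: abs_of_nonneg integral_nonneg)
  qed
qed

text \<open>Only the upper half of the convergence of norms is stated, since Scheffe's lemma asks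
  for a limsup. The parameter \<eta> is fixed so that the factor (1 + \<eta>) powr p costs less than
  e/2; the coefficient of the vanishing error is then fixed too.\<close>

lemma integral_powr_eventually_le:
  fixes f :: "nat \<Rightarrow> real^3 \<Rightarrow> real"
  assumes p: "p \<ge> 1" and f: "\<And>n. continuous_on S2 (f n)" and g: "in_Lp p g"
    and lim: "(\<lambda>n. \<integral>x. \<bar>f n x - g x\<bar> powr p \<partial>sphere_area) \<longlonglongrightarrow> 0" and e: "e > 0"
  shows "\<forall>\<^sub>F n in sequentially. (\<integral>x. \<bar>f n x\<bar> powr p \<partial>sphere_area) \<le> (\<integral>x. \<bar>g x\<bar> powr p \<partial>sphere_area) + e"
proof -
  define I where "I = (\<integral>x. \<bar>g x\<bar> powr p \<partial>sphere_area)"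
  have "((\<lambda>\<eta>. (1 + \<eta>) powr p * I) \<longlongrightarrow> (1 + 0) powr p * I) (at_right 0)"
    by (intro tendsto_intros) auto
  then have "\<forall>\<^sub>F \<eta> in at_right 0. (1 + \<eta>) powr p * I < I + e / 2"
    by (rule order_tendstoD(2)) (use e in simp)
  then have "\<forall>\<^sub>F \<eta> in at_right (0::real). (1 + \<eta>) powr p * I < I + e / 2 \<and> 0 < \<eta>"
    by (intro eventually_conj eventually_at_right_less)
  then obtain \<eta> where \<eta>: "(1 + \<eta>) powr p * I < I + e / 2" "\<eta> > 0"
    using eventually_happens trivial_limit_at_right_real by blast
  have "(\<lambda>n. ((1 + \<eta>) / \<eta>) powr p * (\<integral>x. \<bar>f n x - g x\<bar> powr p \<partial>sphere_area)) \<longlonglongrightarrow> 0"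
    using tendsto_mult_right_zero[OF lim] .
  then have "\<forall>\<^sub>F n in sequentially. ((1 + \<eta>) / \<eta>) powr p * (\<integral>x. \<bar>f n x - g x\<bar> powr p \<partial>sphere_area) < e / 2"
    by (rule order_tendstoD(2)) (use e in simp)
  then show ?thesis
  proof eventually_elim
    case (elim n)
    have "integrable sphere_area (\<lambda>x. \<bar>f n x\<bar> powr p)"
      using p by (intro integrable_continuous_S2 continuous_on_powr' continuous_intros f) auto
    then have "(\<integral>x. \<bar>f n x\<bar> powr p \<partial>sphere_area)
        \<le> (\<integral>x. (1 + \<eta>) powr p * \<bar>g x\<bar> powr p + ((1 + \<eta>) / \<eta>) powr p * \<bar>f n x - g x\<bar> powr p \<partial>sphere_area)"
      using powr_le_perturbed[OF p \<eta>(2)] integrable_powr_diff[OF p f g] g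
      by (intro integral_mono) (auto simp: in_Lp_def)
    also have "\<dots> = (1 + \<eta>) powr p * I + ((1 + \<eta>) / \<eta>) powr p * (\<integral>x. \<bar>f n x - g x\<bar> powr p \<partial>sphere_area)"
      using integrable_powr_diff[OF p f g] g by (simp add: I_def in_Lp_def)
    finally show ?case using elim \<eta>(1) by (simp add: I_def)
  qed
qed

text \<open>Scheffe's lemma is a statement in L^1. It is applied to the images under
  \<open>signed_powr\<close>, whose L^1 norms are the p-th power integrals, and
  \<open>powr_abs_diff_le_signed_powr\<close> leads back to L^p.\<close>

lemma Lp_tendsto_of_AE_tendsto:
  fixes f :: "nat \<Rightarrow> real^3 \<Rightarrow> real"
  assumes p: "p \<ge> 1" and f: "\<And>n. continuous_on S2 (f n)" and g: "in_Lp p g"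
    and AE: "AE x in sphere_area. (\<lambda>n. f n x) \<longlonglongrightarrow> g x"
    and le: "\<And>e. e > 0 \<Longrightarrow> \<forall>\<^sub>F n in sequentially.
      (\<integral>x. \<bar>f n x\<bar> powr p \<partial>sphere_area) \<le> (\<integral>x. \<bar>g x\<bar> powr p \<partial>sphere_area) + e"
  shows "(\<lambda>n. \<integral>x. \<bar>f n x - g x\<bar> powr p \<partial>sphere_area) \<longlonglongrightarrow> 0"
proof -
  let ?S = "signed_powr p"
  have cS: "continuous_on UNIV ?S" using p by (intro continuous_on_signed_powr) auto
  have [measurable]: "?S \<in> borel_measurable borel"
    using cS by (rule borel_measurable_continuous_onI)
  have [measurable]: "g \<in> borel_measurable sphere_area" using g by (simp add: in_Lp_def)
  have iF: "integrable sphere_area (\<lambda>x. ?S (f n x))" for n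
    by (intro integrable_continuous_S2 continuous_on_compose2[OF cS f]) auto
  have ig: "integrable sphere_area (\<lambda>x. ?S (g x))"
    by (rule Bochner_Integration.integrable_bound[of _ "\<lambda>x. \<bar>g x\<bar> powr p"])
      (use g in \<open>auto simp: in_Lp_def abs_signed_powr\<close>)
  have nn: "(\<integral>\<^sup>+x. norm (?S (h x)) \<partial>sphere_area) = ennreal (\<integral>x. \<bar>h x\<bar> powr p \<partial>sphere_area)"
    if "integrable sphere_area (\<lambda>x. ?S (h x))" for h
    using nn_integral_eq_integral[OF integrable_norm[OF that]] by (simp add: abs_signed_powr)
  have "(\<lambda>n. \<integral>\<^sup>+x. norm (?S (f n x) - ?S (g x)) \<partial>sphere_area) \<longlonglongrightarrow> 0"
  proof (rule Scheffe_lemma1[OF iF ig])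
    show "AE x in sphere_area. (\<lambda>n. ?S (f n x)) \<longlonglongrightarrow> ?S (g x)"
      using AE
    proof eventually_elim
      case (elim x)
      then show ?case using cS by (intro continuous_on_tendsto_compose[OF cS]) auto
    qed
    show "limsup (\<lambda>n. \<integral>\<^sup>+x. norm (?S (f n x)) \<partial>sphere_area) \<le> (\<integral>\<^sup>+x. norm (?S (g x)) \<partial>sphere_area)"
      unfolding nn[OF iF] nn[OF ig]
    proof (rule ennreal_le_epsilon)
      fix e :: real assume e: "0 < e"
      have "ennreal (\<integral>x. \<bar>g x\<bar> powr p \<partial>sphere_area) + ennreal e = ennreal ((\<integral>x. \<bar>g x\<bar> powr p \<partial>sphere_area) + e)"
        using e by (intro ennreal_plus[symmetric] Bochner_Integration.integral_nonneg) auto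
      then show "limsup (\<lambda>n. ennreal (\<integral>x. \<bar>f n x\<bar> powr p \<partial>sphere_area))
          \<le> ennreal (\<integral>x. \<bar>g x\<bar> powr p \<partial>sphere_area) + ennreal e"
        using le[OF e] by (auto intro!: Limsup_bounded ennreal_leI elim!: eventually_mono)
    qed
  qed
  moreover have "(\<integral>\<^sup>+x. norm (?S (f n x) - ?S (g x)) \<partial>sphere_area)
      = ennreal (\<integral>x. \<bar>?S (f n x) - ?S (g x)\<bar> \<partial>sphere_area)" for n
    using nn_integral_eq_integral[OF integrable_norm[OF Bochner_Integration.integrable_diff[OF iF ig]]] by simp
  ultimately have "(\<lambda>n. ennreal (\<integral>x. \<bar>?S (f n x) - ?S (g x)\<bar> \<partial>sphere_area)) \<longlonglongrightarrow> ennreal 0"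
    by simp
  then have "(\<lambda>n. \<integral>x. \<bar>?S (f n x) - ?S (g x)\<bar> \<partial>sphere_area) \<longlonglongrightarrow> 0"
    by (subst (asm) tendsto_ennreal_iff) (auto intro!: always_eventually Bochner_Integration.integral_nonneg)
  then have lim: "(\<lambda>n. 2 powr p * (\<integral>x. \<bar>?S (f n x) - ?S (g x)\<bar> \<partial>sphere_area)) \<longlonglongrightarrow> 0"
    by (rule tendsto_mult_right_zero)
  have "(\<integral>x. \<bar>f n x - g x\<bar> powr p \<partial>sphere_area) \<le> (\<integral>x. 2 powr p * \<bar>?S (f n x) - ?S (g x)\<bar> \<partial>sphere_area)" for n
    by (intro integral_mono integrable_powr_diff[OF p f g] powr_abs_diff_le_signed_powr[OF p])
      (use iF ig in auto)
  then have "(\<integral>x. \<bar>f n x - g x\<bar> powr p \<partial>sphere_area) \<le> 2 powr p * (\<integral>x. \<bar>?S (f n x) - ?S (g x)\<bar> \<partial>sphere_area)" for n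
    by simp
  then show ?thesis
    by (intro tendsto_sandwich[OF _ _ tendsto_const lim] always_eventually allI Bochner_Integration.integral_nonneg) auto
qed

text \<open>Only the conserved quantities enter, not the equation. The statement thus also applies
  to negated vorticities, whether or not they solve it, and this settles non-increasing
  profiles.\<close>

lemma stability_along_sequences:
  fixes f f0 :: "nat \<Rightarrow> real^3 \<Rightarrow> real"
  assumes p: "p \<ge> 1" and g: "in_Lp p g"
    and h: "mono_on {-1<..<1} h" and gh: "AE x in sphere_area. g x = h (x $ 3)"
    and f: "\<And>n. continuous_on S2 (f n)" and f0: "\<And>n. continuous_on S2 (f0 n)"
    and casimir: "\<And>n (F :: real \<Rightarrow> real). continuous_on UNIV F \<Longrightarrow>
      (\<integral>x. F (f n x) \<partial>sphere_area) = (\<integral>x. F (f0 n x) \<partial>sphere_area)"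
    and momentum: "\<And>n. (\<integral>x. x $ 3 * f n x \<partial>sphere_area) = (\<integral>x. x $ 3 * f0 n x \<partial>sphere_area)"
    and lim: "(\<lambda>n. Lp_norm p (\<lambda>x. f0 n x - g x)) \<longlonglongrightarrow> 0"
  shows "\<exists>r. strict_mono r \<and> (\<lambda>n. Lp_norm p (\<lambda>x. f (r n) x - g x)) \<longlonglongrightarrow> 0"
proof -
  obtain F :: "real \<Rightarrow> real" where lip: "\<And>a b. \<bar>F a - F b\<bar> \<le> \<bar>a - b\<bar>"
    and sub: "\<And>s y. s \<in> {-1<..<1} \<Longrightarrow> s * (y - h s) \<le> F y - F (h s)"
    and gap: "\<And>s \<eta>. s \<in> {-1<..<1} \<Longrightarrow> isCont h s \<Longrightarrow> \<eta> > 0 \<Longrightarrow>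
      \<exists>c>0. \<forall>y. \<bar>y - h s\<bar> \<ge> \<eta> \<longrightarrow> c \<le> F y - F (h s) - s * (y - h s)"
    using mono_profile_conjugate[OF h] by blast
  have F: "continuous_on UNIV F"
  proof (rule continuous_onI)
    fix x e :: real assume "e > 0"
    then show "\<exists>d>0. \<forall>y\<in>UNIV. dist y x < d \<longrightarrow> dist (F y) (F x) \<le> e"
      by (intro exI[of _ e]) (auto simp: dist_real_def intro!: order_trans[OF lip])
  qed
  have [measurable]: "F \<in> borel_measurable borel" using F by (rule borel_measurable_continuous_onI)
  have gi: "integrable sphere_area g" by (rule in_Lp_imp_integrable[OF p g])
  then have [measurable]: "g \<in> borel_measurable sphere_area" by auto
  have Fg: "integrable sphere_area (\<lambda>x. F (g x))"
  proof (rule Bochner_Integration.integrable_bound)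
    show "integrable sphere_area (\<lambda>x. \<bar>F 0\<bar> + \<bar>g x\<bar>)" using gi by simp
    have "\<bar>F y\<bar> \<le> \<bar>F 0\<bar> + \<bar>y\<bar>" for y using lip[of y 0] by linarith
    then show "AE x in sphere_area. norm (F (g x)) \<le> norm (\<bar>F 0\<bar> + \<bar>g x\<bar>)" by simp
  qed measurable
  have x3: "\<bar>x $ 3\<bar> \<le> 1" if "x \<in> S2" for x :: "real^3"
    using component_le_norm_cart[of x 3] that by simp
  have xg: "integrable sphere_area (\<lambda>x. x $ 3 * g x)"
  proof (rule Bochner_Integration.integrable_bound[OF gi])
    have "(\<lambda>x::real^3. x $ 3) \<in> borel_measurable sphere_area"
      by (intro borel_measurable_continuous_S2 continuous_intros)
    then show "(\<lambda>x. x $ 3 * g x) \<in> borel_measurable sphere_area" by measurable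
    show "AE x in sphere_area. norm (x $ 3 * g x) \<le> norm (g x)"
      using x3 by (intro AE_I2) (auto simp: abs_mult mult_left_le_one_le)
  qed
  \<comment> \<open>The Bregman divergence of \<open>F\<close> between u and g, with x_3 as the
    subgradient at g(x).\<close>
  define d where "d u x = F (u x) - F (g x) - x $ 3 * (u x - g x)" for u :: "real^3 \<Rightarrow> real" and x
  have cu: "integrable sphere_area u" "integrable sphere_area (\<lambda>x. F (u x))" "integrable sphere_area (\<lambda>x. x $ 3 * u x)"
    if "continuous_on S2 u" for u :: "real^3 \<Rightarrow> real"
    using that by (auto intro!: integrable_continuous_S2 continuous_intros continuous_on_compose2[OF F])
  have di: "integrable sphere_area (d u)" and
    d_int: "(\<integral>x. d u x \<partial>sphere_area) = (\<integral>x. F (u x) \<partial>sphere_area) - (\<integral>x. F (g x) \<partial>sphere_area)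
      - (\<integral>x. x $ 3 * u x \<partial>sphere_area) + (\<integral>x. x $ 3 * g x \<partial>sphere_area)"
    if "continuous_on S2 u" for u
    using cu[OF that] Fg xg by (simp_all add: d_def[abs_def] right_diff_distrib)
  \<comment> \<open>A monotone profile has countably many discontinuities, and each excludes only a
    null circle of latitude.\<close>
  have good: "AE x in sphere_area. g x = h (x $ 3) \<and> x $ 3 \<in> {-1<..<1} \<and> isCont h (x $ 3)"
  proof -
    have "countable {s \<in> {-1<..<1}. \<not> isCont h s}"
      by (rule mono_on_ctble_discont_open[OF _ h]) auto
    then have "AE x in sphere_area. \<forall>c\<in>{s \<in> {-1<..<1}. \<not> isCont h s}. x $ 3 \<noteq> c"
      by (subst AE_ball_countable) (auto intro: AE_sphere_area_height_neq)
    then show ?thesis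
      using gh AE_sphere_area_height_neq[of 1] AE_sphere_area_height_neq[of "-1"] AE_space
    proof eventually_elim
      case (elim x)
      then have "\<bar>x $ 3\<bar> \<le> 1" using x3[of x] by simp
      with elim have "x $ 3 \<in> {-1<..<1}" by auto
      with elim show ?case by blast
    qed
  qed
  have d_nonneg: "AE x in sphere_area. 0 \<le> d u x" for u
    using good
  proof eventually_elim
    case (elim x)
    then show ?case using sub[of "x $ 3" "u x"] by (simp add: d_def)
  qed
  have limp: "(\<lambda>n. \<integral>x. \<bar>f0 n x - g x\<bar> powr p \<partial>sphere_area) \<longlonglongrightarrow> 0"
    using Lp_norm_tendsto_0[OF _ lim] p by simp
  have lim1: "(\<lambda>n. 2 * (\<integral>x. \<bar>f0 n x - g x\<bar> \<partial>sphere_area)) \<longlonglongrightarrow> 0"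
    by (intro tendsto_mult_right_zero L1_tendsto_of_Lp_tendsto[OF p] limp integrable_powr_diff[OF p f0 g]
        Bochner_Integration.integrable_diff cu f0 gi)
  have d_bound: "(\<integral>x. norm (d (f n) x) \<partial>sphere_area) \<le> 2 * (\<integral>x. \<bar>f0 n x - g x\<bar> \<partial>sphere_area)" for n
  proof -
    have "(\<integral>x. norm (d (f n) x) \<partial>sphere_area) = (\<integral>x. d (f n) x \<partial>sphere_area)"
      by (rule integral_cong_AE) (use di[OF f] d_nonneg[of "f n"] in auto)
    \<comment> \<open>Up to terms in g alone, the integral of \<open>d\<close> is a Casimir minus
      the momentum.\<close>
    also have "\<dots> = (\<integral>x. d (f0 n) x \<partial>sphere_area)"
      unfolding d_int[OF f] d_int[OF f0] casimir[OF F] momentum ..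
    \<comment> \<open>One unit of the factor 2 comes from the Lipschitz bound for \<open>F\<close>,
      the other from |x_3| \<le> 1.\<close>
    also have "\<dots> \<le> (\<integral>x. 2 * \<bar>f0 n x - g x\<bar> \<partial>sphere_area)"
    proof (intro integral_mono di f0)
      have le: "u - v \<le> 2 * w" if "\<bar>v\<bar> \<le> w" "\<bar>u\<bar> \<le> w" for u v w :: real
        using that by linarith
      fix x assume "x \<in> space sphere_area"
      then have "\<bar>x $ 3 * (f0 n x - g x)\<bar> \<le> \<bar>f0 n x - g x\<bar>"
        using x3[of x] by (simp add: abs_mult mult_left_le_one_le)
      then show "d (f0 n) x \<le> 2 * \<bar>f0 n x - g x\<bar>"
        unfolding d_def by (rule le) (rule lip)
    qed (use cu[OF f0] gi in auto)
    finally show ?thesis by simp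
  qed
  have "(\<lambda>n. \<integral>x. norm (d (f n) x) \<partial>sphere_area) \<longlonglongrightarrow> 0"
    by (rule tendsto_sandwich[OF _ _ tendsto_const lim1])
      (auto intro!: always_eventually d_bound Bochner_Integration.integral_nonneg simp del: real_norm_def)
  from tendsto_L1_AE_subseq[OF di[OF f] this]
  obtain r where r: "strict_mono r" and AEd: "AE x in sphere_area. (\<lambda>n. d (f (r n)) x) \<longlonglongrightarrow> 0"
    by blast
  have "AE x in sphere_area. (\<lambda>n. f (r n) x) \<longlonglongrightarrow> g x"
    using AEd good
  proof eventually_elim
    case (elim x)
    show ?case
    proof (rule LIMSEQ_I)
      fix \<eta> :: real assume "\<eta> > 0"
      \<comment> \<open>By contraposition, a divergence below c forces the value of f to lie within
        \<eta> of g(x).\<close>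
      then obtain c where c: "c > 0" "\<And>y. \<bar>y - h (x $ 3)\<bar> \<ge> \<eta> \<Longrightarrow> c \<le> F y - F (h (x $ 3)) - x $ 3 * (y - h (x $ 3))"
        using gap elim(2) by meson
      have "\<forall>\<^sub>F n in sequentially. d (f (r n)) x < c"
        using order_tendstoD(2)[OF elim(1) c(1)] .
      then show "\<exists>N. \<forall>n\<ge>N. norm (f (r n) x - g x) < \<eta>"
        using c(2) elim(2) unfolding eventually_sequentially d_def real_norm_def
        by (metis linorder_not_le)
    qed
  qed
  moreover have "\<forall>\<^sub>F n in sequentially. (\<integral>x. \<bar>f (r n) x\<bar> powr p \<partial>sphere_area) \<le> (\<integral>x. \<bar>g x\<bar> powr p \<partial>sphere_area) + e"
    if "e > 0" for e
  proof -
    have "continuous_on UNIV (\<lambda>y::real. \<bar>y\<bar> powr p)"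
      using p by (intro continuous_on_powr' continuous_intros) auto
    from casimir[OF this]
    have "(\<integral>x. \<bar>f (r n) x\<bar> powr p \<partial>sphere_area) = (\<integral>x. \<bar>f0 (r n) x\<bar> powr p \<partial>sphere_area)" for n .
    moreover have "(\<lambda>n. \<integral>x. \<bar>f0 (r n) x - g x\<bar> powr p \<partial>sphere_area) \<longlonglongrightarrow> 0"
      using LIMSEQ_subseq_LIMSEQ[OF limp r] by (simp add: comp_def)
    ultimately show ?thesis
      using integral_powr_eventually_le[OF p f0 g _ that, of r] by simp
  qed
  ultimately have "(\<lambda>n. \<integral>x. \<bar>f (r n) x - g x\<bar> powr p \<partial>sphere_area) \<longlonglongrightarrow> 0"
    by (intro Lp_tendsto_of_AE_tendsto[OF p f g])
  then have "(\<lambda>n. (\<integral>x. \<bar>f (r n) x - g x\<bar> powr p \<partial>sphere_area) powr (1 / p)) \<longlonglongrightarrow> 0 powr (1 / p)"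
    by (rule tendsto_powr') (use p in \<open>auto intro!: always_eventually Bochner_Integration.integral_nonneg\<close>)
  then have "(\<lambda>n. Lp_norm p (\<lambda>x. f (r n) x - g x)) \<longlonglongrightarrow> 0"
    by (simp add: Lp_norm_def)
  with r show ?thesis by blast
qed

theorem theorem5p10:
  fixes p \<omega> :: real and \<zeta>' :: "real^3 \<Rightarrow> real"
  assumes "1 < p"
    and "in_Lp p \<zeta>'" and "zero_mean \<zeta>'"
    and "monotone_zonal \<zeta>'"
  shows "\<forall>\<epsilon>>0. \<exists>\<delta>>0. \<forall>\<zeta>. smooth_solution \<omega> \<zeta> \<longrightarrow>
           Lp_norm p (\<lambda>x. \<zeta> x 0 - \<zeta>' x) < \<delta> \<longrightarrow>
           (\<forall>t>0. Lp_norm p (\<lambda>x. \<zeta> x t - \<zeta>' x) < \<epsilon>)"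
proof (rule ccontr)
  define A where "A \<zeta> = Lp_norm p (\<lambda>x. \<zeta> x 0 - \<zeta>' x)" for \<zeta> :: "real^3 \<Rightarrow> real \<Rightarrow> real"
  define B where "B \<zeta> t = Lp_norm p (\<lambda>x. \<zeta> x t - \<zeta>' x)" for \<zeta> :: "real^3 \<Rightarrow> real \<Rightarrow> real" and t
  assume "\<not> ?thesis"
  then have "\<not> (\<forall>\<epsilon>>0. \<exists>\<delta>>0. \<forall>\<zeta>. smooth_solution \<omega> \<zeta> \<longrightarrow> A \<zeta> < \<delta> \<longrightarrow> (\<forall>t>0. B \<zeta> t < \<epsilon>))"
    unfolding A_def B_def .
  then obtain \<epsilon> where \<epsilon>: "\<epsilon> > 0" and
    bad: "\<And>\<delta>. \<delta> > 0 \<Longrightarrow> \<exists>\<zeta> t. smooth_solution \<omega> \<zeta> \<and> A \<zeta> < \<delta> \<and> t > 0 \<and> \<not> B \<zeta> t < \<epsilon>"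
    unfolding not_all not_ex not_imp de_Morgan_conj by (elim exE conjE) (rule that; auto)
  \<comment> \<open>The choice \<delta> = 1/(n + 1) sends the initial errors to zero, while each
    solution comes with its own bad time.\<close>
  have "\<forall>n. \<exists>\<zeta> t. smooth_solution \<omega> \<zeta> \<and> A \<zeta> < inverse (real (Suc n)) \<and> t > 0 \<and> \<not> B \<zeta> t < \<epsilon>"
    by (intro allI bad) simp
  then obtain \<zeta> t where sol: "\<And>n. smooth_solution \<omega> (\<zeta> n)" and t: "\<And>n. t n > 0"
    and small: "\<And>n. Lp_norm p (\<lambda>x. \<zeta> n x 0 - \<zeta>' x) < inverse (real (Suc n))"
    and big: "\<And>n. \<not> Lp_norm p (\<lambda>x. \<zeta> n x (t n) - \<zeta>' x) < \<epsilon>"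
    unfolding A_def[symmetric] B_def[symmetric] by metis
  have p: "p \<ge> 1" using assms(1) by simp
  have cont: "continuous_on S2 (\<lambda>x. \<zeta> n x s)" if "s \<ge> 0" for n s
  proof -
    have "smooth_on S2 (\<lambda>x. \<zeta> n x s)"
      using smooth_on_time_slice[of S2 "{0..}" "\<zeta> n" s] sol[of n] that by (simp add: smooth_solution_def)
    from Ck_on_imp_continuous_on[OF _ smooth_on_imp_Ck_on_sgn[OF this]]
    have "continuous_on S2 (\<lambda>x. \<zeta> n (sgn x) s)" by (intro continuous_on_S2_punctured) auto
    then show ?thesis by (rule continuous_on_eq) (simp add: sgn_div_norm)
  qed
  have casimir: "(\<integral>x. F (\<zeta> n x (t n)) \<partial>sphere_area) = (\<integral>x. F (\<zeta> n x 0) \<partial>sphere_area)"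
    if "continuous_on UNIV F" for n and F :: "real \<Rightarrow> real"
    using t[of n]
    by (intro integral_comp_eq_of_moments[OF cont cont that] smooth_solution_conserves_power[OF sol]) auto
  have momentum: "(\<integral>x. x $ 3 * \<zeta> n x (t n) \<partial>sphere_area) = (\<integral>x. x $ 3 * \<zeta> n x 0 \<partial>sphere_area)" for n
    using smooth_solution_conserves_momentum[OF sol, of "t n" n] t[of n] by simp
  have lim: "(\<lambda>n. Lp_norm p (\<lambda>x. \<zeta> n x 0 - \<zeta>' x)) \<longlonglongrightarrow> 0"
    by (rule tendsto_sandwich[OF _ _ tendsto_const LIMSEQ_inverse_real_of_nat], rule always_eventually)
      (simp add: Lp_norm_def, intro always_eventually allI less_imp_le[OF small])
  have neg: "Lp_norm p (\<lambda>x. - u x - - v x) = Lp_norm p (\<lambda>x. u x - v x)" for u v :: "real^3 \<Rightarrow> real"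
    by (simp add: Lp_norm_def abs_minus_commute)
  obtain h where h: "mono_on {-1<..<1} h \<or> antimono_on {-1<..<1} h" "AE x in sphere_area. \<zeta>' x = h (x $ 3)"
    using assms(4) unfolding monotone_zonal_def by blast
  from h(1) have "\<exists>r. strict_mono r \<and> (\<lambda>n. Lp_norm p (\<lambda>x. \<zeta> (r n) x (t (r n)) - \<zeta>' x)) \<longlonglongrightarrow> 0"
  proof
    assume "mono_on {-1<..<1} h"
    from stability_along_sequences[OF p assms(2) this h(2), of "\<lambda>n x. \<zeta> n x (t n)" "\<lambda>n x. \<zeta> n x 0"]
    show ?thesis
      using cont t casimir momentum lim by (simp add: less_imp_le)
  next
    assume "antimono_on {-1<..<1} h"
    then have h': "mono_on {-1<..<1} (\<lambda>s. - h s)"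
      by (auto simp: monotone_on_def)
    have g': "in_Lp p (\<lambda>x. - \<zeta>' x)" using assms(2) by (simp add: in_Lp_def)
    have gh': "AE x in sphere_area. - \<zeta>' x = - h (x $ 3)" using h(2) by auto
    \<comment> \<open>A Casimir of the negated vorticity is the Casimir of the solution for the
      reflected function y \<mapsto> F (- y).\<close>
    have "(\<integral>x. F (- \<zeta> n x (t n)) \<partial>sphere_area) = (\<integral>x. F (- \<zeta> n x 0) \<partial>sphere_area)"
      if "continuous_on UNIV F" for n and F :: "real \<Rightarrow> real"
    proof (rule casimir)
      show "continuous_on UNIV (\<lambda>y. F (- y))"
        by (rule continuous_on_compose2[OF that]) (auto intro: continuous_intros)
    qed
    with stability_along_sequences[OF p g' h' gh', of "\<lambda>n x. - \<zeta> n x (t n)" "\<lambda>n x. - \<zeta> n x 0"]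
    have "\<exists>r. strict_mono r \<and> (\<lambda>n. Lp_norm p (\<lambda>x. - \<zeta> (r n) x (t (r n)) - - \<zeta>' x)) \<longlonglongrightarrow> 0"
      unfolding neg using cont t momentum lim by (simp add: less_imp_le continuous_intros)
    then show ?thesis unfolding neg .
  qed
  then obtain r where "(\<lambda>n. Lp_norm p (\<lambda>x. \<zeta> (r n) x (t (r n)) - \<zeta>' x)) \<longlonglongrightarrow> 0" by blast
  from order_tendstoD(2)[OF this \<epsilon>] big show False
    by (auto simp: eventually_sequentially)
qed

end
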